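(* Let $G=(V,E)$ be a graph on $n$ vertices with maximum degree $d$. Let $\alpha,\epsilon\in(0,1]$ and let $\vec z\in\mathbb{C}^V$ satisfy $(1+\alpha)\cdot|\vec z|\in\mathcal{S}_G$. Then a $(1+\epsilon)$-approximation to $Z_G(\vec z)$ can be computed in time $\left(\frac{n}{\epsilon\alpha}\right)^{O(\log(d)/\sqrt{\alpha})}$.
   Context: For a graph $G=(V,E)$ and $\vec x=(x_v)_{v\in V}\in\mathbb{C}^V$, the (multivariate) independence polynomial is $Z_G(\vec x)=\sum_{I}\prod_{v\in I}x_v$, the sum over all independent sets $I$ of $G$ (including $\emptyset$). For $\vec z\in\mathbb{C}^V$, $|\vec z|$ denotes the vector of coordinate-wise absolute values, and inequalities between vectors are coordinate-wise. The Shearer region of $G$ is $\mathcal{S}_G=\{\vec p\in[0,1]^V : Z_G(\vec z)\neq 0 \text{ for all } \vec z\in\mathbb{C}^V \text{ with } |\vec z|\le \vec p\}$. A $(1+\epsilon)$-approximation to a complex number $Z$ is a number $W$ with $|W-Z|\le\epsilon|Z|$.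
   Formalization: The time bound uses max(n,2) and max(d,2) in place of n and d, since log d is 0 for d = 1 (the literal bound would be time 1) and undefined for d = 0; time counts unit-cost exact operations on complex numbers. *)

theory Defs
  imports Complex_Main
begin

section \<open>Graphs and the independence polynomial\<close>

definition sgraph :: "'a set \<Rightarrow> 'a set set \<Rightarrow> bool" where
  "sgraph V E \<longleftrightarrow> finite V \<and> (\<forall>e\<in>E. e \<subseteq> V \<and> card e = 2)"

definition vdegree :: "'a set set \<Rightarrow> 'a \<Rightarrow> nat" where
  "vdegree E v = card {e \<in> E. v \<in> e}"

text \<open>The 0 only matters for the graph without vertices.\<close>
definition max_degree :: "'a set \<Rightarrow> 'a set set \<Rightarrow> nat" where
  "max_degree V E = Max (insert 0 (vdegree E ` V))"

definition indep_sets :: "'a set \<Rightarrow> 'a set set \<Rightarrow> 'a set set" where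
  "indep_sets V E = {I. I \<subseteq> V \<and> (\<forall>u\<in>I. \<forall>v\<in>I. {u, v} \<notin> E)}"

definition indep_poly :: "'a set \<Rightarrow> 'a set set \<Rightarrow> ('a \<Rightarrow> complex) \<Rightarrow> complex" where
  "indep_poly V E x = (\<Sum>I\<in>indep_sets V E. \<Prod>v\<in>I. x v)"

text \<open>Vectors indexed by \<open>V\<close> are functions on the ambient type; only their values on \<open>V\<close> matter.\<close>
definition shearer_region :: "'a set \<Rightarrow> 'a set set \<Rightarrow> ('a \<Rightarrow> real) set" where
  "shearer_region V E =
     {p. (\<forall>v\<in>V. 0 \<le> p v \<and> p v \<le> 1) \<and>
         (\<forall>z :: 'a \<Rightarrow> complex. (\<forall>v\<in>V. cmod (z v) \<le> p v) \<longrightarrow> indep_poly V E z \<noteq> 0)}"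

text \<open>\<open>W\<close> is a \<open>(1 + \<epsilon>)\<close>-approximation to \<open>Z\<close>.\<close>
definition is_approx :: "real \<Rightarrow> complex \<Rightarrow> complex \<Rightarrow> bool" where
  "is_approx \<epsilon> Z W \<longleftrightarrow> cmod (W - Z) \<le> \<epsilon> * cmod Z"

section \<open>Model of computation\<close>

text \<open>
  A structured random access machine over the complex numbers (a real RAM). The memory consists of
  named arrays of natural numbers and named arrays of complex numbers; array indices are computed
  expressions, which gives indirect addressing. Exact complex arithmetic and comparison of real
  parts are available at unit cost, as usual for algorithms on arbitrary complex inputs.

  The instruction set is restricted so that unit cost is not abused:
  there is no multiplication, division or bit operation on natural numbers;
  there is no rounding (floor) from complex to natural numbers;
  the only constants in a program are natural numbers and \<open>\<i>\<close>, so that no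
  information can be hidden in the digits of a real constant.
  Division by zero yields 0, which a program could also arrange by two comparisons.
\<close>

datatype nexp =
    Num nat
  | NCell string nexp
  | NAdd nexp nexp
  | NSub nexp nexp

datatype cexp =
    OfNat nexp
  | Imag
  | CCell string nexp
  | CAdd cexp cexp
  | CSub cexp cexp
  | CMul cexp cexp
  | CDiv cexp cexp
  | CRe cexp
  | CIm cexp

datatype bexp =
    NLe nexp nexp
  | ReLe cexp cexp
  | BNot bexp
  | BAnd bexp bexp

datatype com =
    Skip
  | NAssign string nexp nexp
  | CAssign string nexp cexp
  | Seq com com
  | Cond bexp com com
  | Loop bexp com
  | Call nat

record state =
  nmem :: "string \<Rightarrow> nat \<Rightarrow> nat"
  cmem :: "string \<Rightarrow> nat \<Rightarrow> complex"

fun nval :: "nexp \<Rightarrow> state \<Rightarrow> nat" where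
  "nval (Num k) s = k"
| "nval (NCell a i) s = nmem s a (nval i s)"
| "nval (NAdd i j) s = nval i s + nval j s"
| "nval (NSub i j) s = nval i s - nval j s"

fun cval :: "cexp \<Rightarrow> state \<Rightarrow> complex" where
  "cval (OfNat i) s = of_nat (nval i s)"
| "cval Imag s = \<i>"
| "cval (CCell a i) s = cmem s a (nval i s)"
| "cval (CAdd x y) s = cval x s + cval y s"
| "cval (CSub x y) s = cval x s - cval y s"
| "cval (CMul x y) s = cval x s * cval y s"
| "cval (CDiv x y) s = cval x s / cval y s"
| "cval (CRe x) s = of_real (Re (cval x s))"
| "cval (CIm x) s = of_real (Im (cval x s))"

fun bval :: "bexp \<Rightarrow> state \<Rightarrow> bool" where
  "bval (NLe i j) s \<longleftrightarrow> nval i s \<le> nval j s"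
| "bval (ReLe x y) s \<longleftrightarrow> Re (cval x s) \<le> Re (cval y s)"
| "bval (BNot b) s \<longleftrightarrow> \<not> bval b s"
| "bval (BAnd b c) s \<longleftrightarrow> bval b s \<and> bval c s"

text \<open>Every constant, memory access, operation and comparison in an expression costs 1.\<close>

fun ncost :: "nexp \<Rightarrow> nat" where
  "ncost (Num k) = 1"
| "ncost (NCell a i) = 1 + ncost i"
| "ncost (NAdd i j) = 1 + ncost i + ncost j"
| "ncost (NSub i j) = 1 + ncost i + ncost j"

fun ccost :: "cexp \<Rightarrow> nat" where
  "ccost (OfNat i) = 1 + ncost i"
| "ccost Imag = 1"
| "ccost (CCell a i) = 1 + ncost i"
| "ccost (CAdd x y) = 1 + ccost x + ccost y"
| "ccost (CSub x y) = 1 + ccost x + ccost y"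
| "ccost (CMul x y) = 1 + ccost x + ccost y"
| "ccost (CDiv x y) = 1 + ccost x + ccost y"
| "ccost (CRe x) = 1 + ccost x"
| "ccost (CIm x) = 1 + ccost x"

fun bcost :: "bexp \<Rightarrow> nat" where
  "bcost (NLe i j) = 1 + ncost i + ncost j"
| "bcost (ReLe x y) = 1 + ccost x + ccost y"
| "bcost (BNot b) = 1 + bcost b"
| "bcost (BAnd b c) = 1 + bcost b + bcost c"

definition nupd :: "string \<Rightarrow> nat \<Rightarrow> nat \<Rightarrow> state \<Rightarrow> state" where
  "nupd a i k s = s\<lparr>nmem := (nmem s)(a := (nmem s a)(i := k))\<rparr>"

definition cupd :: "string \<Rightarrow> nat \<Rightarrow> complex \<Rightarrow> state \<Rightarrow> state" where
  "cupd a i x s = s\<lparr>cmem := (cmem s)(a := (cmem s a)(i := x))\<rparr>"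

text \<open>
  \<open>exec P c s t s'\<close>: started in \<open>s\<close>, the command \<open>c\<close> terminates in \<open>s'\<close> after time \<open>t\<close>.
  \<open>P\<close> lists the bodies of the (possibly recursive) procedures. They have no parameters and no local
  variables, so a call only has to remember where to return to.
\<close>

inductive exec :: "com list \<Rightarrow> com \<Rightarrow> state \<Rightarrow> nat \<Rightarrow> state \<Rightarrow> bool" for P where
  Skip: "exec P Skip s 1 s"
| NAssign: "exec P (NAssign a i e) s (1 + ncost i + ncost e) (nupd a (nval i s) (nval e s) s)"
| CAssign: "exec P (CAssign a i e) s (1 + ncost i + ccost e) (cupd a (nval i s) (cval e s) s)"
| Seq: "exec P c1 s t1 s1 \<Longrightarrow> exec P c2 s1 t2 s2 \<Longrightarrow> exec P (Seq c1 c2) s (t1 + t2) s2"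
| CondTrue: "bval b s \<Longrightarrow> exec P c1 s t s1 \<Longrightarrow> exec P (Cond b c1 c2) s (1 + bcost b + t) s1"
| CondFalse: "\<not> bval b s \<Longrightarrow> exec P c2 s t s1 \<Longrightarrow> exec P (Cond b c1 c2) s (1 + bcost b + t) s1"
| LoopFalse: "\<not> bval b s \<Longrightarrow> exec P (Loop b c) s (1 + bcost b) s"
| LoopTrue: "bval b s \<Longrightarrow> exec P c s t1 s1 \<Longrightarrow> exec P (Loop b c) s1 t2 s2 \<Longrightarrow>
    exec P (Loop b c) s (1 + bcost b + t1 + t2) s2"
| Call: "p < length P \<Longrightarrow> exec P (P ! p) s t s1 \<Longrightarrow> exec P (Call p) s (1 + t) s1"

inductive_cases exec_SkipE: "exec P Skip s t s'"
inductive_cases exec_NAssignE: "exec P (NAssign a i e) s t s'"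
inductive_cases exec_CAssignE: "exec P (CAssign a i e) s t s'"
inductive_cases exec_SeqE: "exec P (Seq c1 c2) s t s'"
inductive_cases exec_CondE: "exec P (Cond b c1 c2) s t s'"
inductive_cases exec_LoopE: "exec P (Loop b c) s t s'"
inductive_cases exec_CallE: "exec P (Call p) s t s'"

text \<open>The result and the running time are determined by the program and the initial state.\<close>
lemma exec_deterministic:
  assumes "exec P c s t s'" and "exec P c s u s''"
  shows "t = u \<and> s' = s''"
  using assms
proof (induction arbitrary: u s'' rule: exec.induct)
  case (Skip s)
  then show ?case by (auto elim: exec_SkipE)
next
  case (NAssign a i e s)
  then show ?case by (auto elim: exec_NAssignE)
next
  case (CAssign a i e s)
  then show ?case by (auto elim: exec_CAssignE)
next
  case (Seq c1 s t1 s1 c2 t2 s2)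
  from Seq.prems obtain u1 u2 r where
    "exec P c1 s u1 r" "exec P c2 r u2 s''" "u = u1 + u2"
    by (rule exec_SeqE)
  with Seq.IH show ?case by metis
next
  case (CondTrue b s c1 t s1 c2)
  from CondTrue.prems CondTrue.hyps obtain u1 where
    "exec P c1 s u1 s''" "u = 1 + bcost b + u1"
    by (auto elim: exec_CondE)
  with CondTrue.IH show ?case by metis
next
  case (CondFalse b s c2 t s1 c1)
  from CondFalse.prems CondFalse.hyps obtain u1 where
    "exec P c2 s u1 s''" "u = 1 + bcost b + u1"
    by (auto elim: exec_CondE)
  with CondFalse.IH show ?case by metis
next
  case (LoopFalse b s c)
  from LoopFalse.prems show ?case
    by (rule exec_LoopE) (simp_all add: LoopFalse.hyps)
next
  case (LoopTrue b s c t1 s1 t2 s2)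
  from LoopTrue.prems obtain u1 u2 r where
    "exec P c s u1 r" "exec P (Loop b c) r u2 s''" "u = 1 + bcost b + u1 + u2"
    by (rule exec_LoopE) (simp_all add: LoopTrue.hyps)
  with LoopTrue.IH show ?case by metis
next
  case (Call p s t s1)
  from Call.prems obtain u1 where "exec P (P ! p) s u1 s''" "u = 1 + u1"
    by (auto elim: exec_CallE)
  with Call.IH show ?case by metis
qed

text \<open>
  The input for a graph with vertex set \<open>{..<n}\<close>: the number of vertices, the adjacency matrix (row by
  row), the vector \<open>z\<close> and the parameters \<open>\<alpha>\<close> and \<open>\<epsilon>\<close>. All other memory is 0.
\<close>
definition input_state ::
    "nat \<Rightarrow> nat set set \<Rightarrow> (nat \<Rightarrow> complex) \<Rightarrow> real \<Rightarrow> real \<Rightarrow> state" where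
  "input_state n E z \<alpha> \<epsilon> =
     \<lparr>nmem = (\<lambda>a i. if a = ''n'' \<and> i = 0 then n
                    else if a = ''adj'' \<and> i < n * n \<and> {i div n, i mod n} \<in> E then 1
                    else 0),
      cmem = (\<lambda>a i. if a = ''z'' \<and> i < n then z i
                    else if a = ''alpha'' \<and> i = 0 then of_real \<alpha>
                    else if a = ''eps'' \<and> i = 0 then of_real \<epsilon>
                    else 0)\<rparr>"

text \<open>
  \<open>P\<close> is the list of procedures of a program, whose execution is a call of the procedure
  number 0; the output is the content of the cell 0 of the array \<open>result\<close>.
\<close>
definition computes_in_time :: "com list \<Rightarrow> state \<Rightarrow> nat \<Rightarrow> complex \<Rightarrow> bool" where
  "computes_in_time P s t W \<longleftrightarrow> (\<exists>s'. exec P (Call 0) s t s' \<and> cmem s' ''result'' 0 = W)"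

end

theory Submission
  imports Defs "HOL-Analysis.L2_Norm"
begin

text \<open>
  The ratio \<open>R = Z\<^sub>A\<^sub>+\<^sub>v / Z\<^sub>A\<close> satisfies \<open>R = 1 + z\<^sub>v / \<Prod> R\<^sub>u\<close>, where \<open>u\<close> ranges over the neighbours of
  \<open>v\<close> in \<open>A\<close> and these neighbours are removed from \<open>A\<close> one after the other (Weitz's tree). The
  algorithm evaluates this recursion up to depth \<open>O(log (n / (\<epsilon> \<alpha>)) / sqrt \<alpha>)\<close> and multiplies the
  ratios of a vertex ordering.

  Write \<open>R = 1 - b\<close>. The truncation error at \<open>z\<close> is dominated by the one at \<open>- |z|\<close>, where \<open>b\<close> becomes
  a number \<open>\<beta> \<in> [0, 1)\<close>, also after scaling \<open>|z|\<close> by \<open>t \<le> 1 + \<alpha>\<close>. One level of the recursion multiplies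
  relative errors by edge weights \<open>w = \<beta> / (1 - \<beta>)\<close>. Let \<open>D = 1 + \<Sum> w D\<close> be the total weight of all
  paths downwards from a node, which is the logarithmic derivative of \<open>\<beta>\<close> in \<open>ln t\<close>. If \<open>D\<close> is small, the
  sum \<open>\<Sum> w D\<close> is smaller than \<open>D\<close> by the factor \<open>1 - 1 / D\<close>; if \<open>D\<close> is large, \<open>w\<close> is smaller than its
  value at \<open>t = 1 + \<alpha> / 2\<close> by the factor \<open>(1 + \<alpha> / 2) powr (- D)\<close>. Combining both by Cauchy-Schwarz, the
  error decays by a factor \<open>exp (- \<Omega>(sqrt \<alpha>))\<close> per level.
\<close>

section \<open>Occupation ratios on trees\<close>

text \<open>The recursion for \<open>b = 1 - R\<close>, cut off after \<open>h\<close> levels with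
  \<open>b = 0\<close>, that is, with ratio 1 at the leaves. Working over an arbitrary field lets
  the complex weights and their real majorants share it.\<close>

primrec occ :: "('x \<Rightarrow> 'x set) \<Rightarrow> ('x \<Rightarrow> 'f::field) \<Rightarrow> nat \<Rightarrow> 'x \<Rightarrow> 'f" where
  "occ ch q 0 x = 0"
| "occ ch q (Suc h) x = q x * (\<Prod>y\<in>ch x. 1 / (1 - occ ch q h y))"

definition is_occ :: "'x set \<Rightarrow> ('x \<Rightarrow> 'x set) \<Rightarrow> ('x \<Rightarrow> 'f::field) \<Rightarrow> ('x \<Rightarrow> 'f) \<Rightarrow> bool" where
  "is_occ N ch q b \<longleftrightarrow> (\<forall>x\<in>N. b x = q x * (\<Prod>y\<in>ch x. 1 / (1 - b y)))"

definition subunit :: "'x set \<Rightarrow> ('x \<Rightarrow> real) \<Rightarrow> bool" where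
  "subunit N \<beta> \<longleftrightarrow> (\<forall>x\<in>N. 0 \<le> \<beta> x \<and> \<beta> x < 1)"

text \<open>The path weight \<open>D\<close> restricted to paths of at most \<open>k\<close> edges;
  the summand 1 is the empty path.\<close>

primrec growth :: "('x \<Rightarrow> 'x set) \<Rightarrow> ('x \<Rightarrow> real) \<Rightarrow> nat \<Rightarrow> 'x \<Rightarrow> real" where
  "growth ch \<beta> 0 x = 1"
| "growth ch \<beta> (Suc k) x = 1 + (\<Sum>y\<in>ch x. \<beta> y / (1 - \<beta> y) * growth ch \<beta> k y)"

section \<open>Elementary inequalities for products and reciprocals\<close>

text \<open>Majorants survive products: the difference of two products is split so that one factor
  changes at a time, and each piece is bounded by the same piece of the real products. The bound
  \<open>cmod (f i) \<le> F i\<close> follows from the two hypotheses by the triangle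
  inequality.\<close>

lemma prod_diff_dominated:
  fixes f g :: "'i \<Rightarrow> complex" and F G :: "'i \<Rightarrow> real"
  assumes "finite S"
    and "\<And>i. i \<in> S \<Longrightarrow> cmod (f i - g i) \<le> F i - G i"
    and "\<And>i. i \<in> S \<Longrightarrow> cmod (g i) \<le> G i"
  shows "cmod (prod f S - prod g S) \<le> prod F S - prod G S"
  using assms
proof (induction S rule: finite_induct)
  case (insert a S)
  have fF: "cmod (f i) \<le> F i" if "i \<in> insert a S" for i
    using insert.prems[OF that] norm_triangle_ineq2[of "f i" "g i"] by linarith
  have G0: "0 \<le> G i" if "i \<in> insert a S" for i
    using insert.prems(2)[OF that] norm_ge_zero order_trans by blast
  have F0: "0 \<le> F a"
    using fF[of a] norm_ge_zero order_trans by blast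
  have IH: "cmod (prod f S - prod g S) \<le> prod F S - prod G S"
    using insert by auto
  have g: "cmod (prod g S) \<le> prod G S"
    unfolding prod_norm[symmetric] using insert.prems(2) by (intro prod_mono) auto
  have "f a * prod f S - g a * prod g S = f a * (prod f S - prod g S) + (f a - g a) * prod g S"
    by (simp add: algebra_simps)
  also have "cmod \<dots> \<le> cmod (f a) * cmod (prod f S - prod g S) + cmod (f a - g a) * cmod (prod g S)"
    by (metis norm_mult norm_triangle_ineq)
  also have "\<dots> \<le> F a * (prod F S - prod G S) + (F a - G a) * prod G S"
  proof (intro add_mono mult_mono)
    show "0 \<le> F a - G a"
      using insert.prems(1)[of a] norm_ge_zero order_trans by blast
  qed (use fF F0 IH g insert.prems in auto)
  also have "\<dots> = F a * prod F S - G a * prod G S"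
    by (simp add: algebra_simps)
  finally show ?case
    using insert by simp
qed simp

text \<open>Majorants survive the map \<open>x \<mapsto> 1 / (1 - x)\<close>: the difference is
  \<open>(b - c) / ((1 - b) * (1 - c))\<close>, and the distance of a number from 1 is at least 1
  minus its majorant.\<close>

lemma norm_one_over_diff_le:
  fixes b c :: complex
  assumes "cmod (b - c) \<le> \<beta> - \<gamma>" and "cmod b \<le> \<beta>" and "cmod c \<le> \<gamma>" and "\<beta> < 1"
  shows "cmod (1 / (1 - b) - 1 / (1 - c)) \<le> 1 / (1 - \<beta>) - 1 / (1 - \<gamma>)"
    and "cmod (1 / (1 - c)) \<le> 1 / (1 - \<gamma>)"
proof -
  have "\<gamma> \<le> \<beta>" using assms(1) norm_ge_zero[of "b - c"] by linarith
  have b: "1 - \<beta> \<le> cmod (1 - b)" and c: "1 - \<gamma> \<le> cmod (1 - c)"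
    using assms norm_triangle_ineq2[of 1 b] norm_triangle_ineq2[of 1 c] by auto
  have nz: "1 - b \<noteq> 0" "1 - c \<noteq> 0"
    using b c assms(4) \<open>\<gamma> \<le> \<beta>\<close> by auto
  have "cmod (1 / (1 - b) - 1 / (1 - c)) = cmod (b - c) / (cmod (1 - b) * cmod (1 - c))"
    using nz by (simp add: diff_frac_eq norm_divide norm_mult)
  also have "\<dots> \<le> (\<beta> - \<gamma>) / ((1 - \<beta>) * (1 - \<gamma>))"
    using assms b c \<open>\<gamma> \<le> \<beta>\<close> by (intro frac_le mult_mono) auto
  also have "\<dots> = 1 / (1 - \<beta>) - 1 / (1 - \<gamma>)"
    using assms(4) \<open>\<gamma> \<le> \<beta>\<close> by (simp add: field_simps)
  finally show "cmod (1 / (1 - b) - 1 / (1 - c)) \<le> 1 / (1 - \<beta>) - 1 / (1 - \<gamma>)" .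
  show "cmod (1 / (1 - c)) \<le> 1 / (1 - \<gamma>)"
    using c assms(4) \<open>\<gamma> \<le> \<beta>\<close> by (simp add: norm_divide frac_le)
qed

text \<open>Weierstrass's product inequality, which linearises the error of a product of ratios. The
  induction step expands \<open>(1 - a j) * (1 - prod a S) \<ge> 0\<close>.\<close>

lemma one_minus_prod_le_sum:
  fixes a :: "'i \<Rightarrow> real"
  assumes "finite S" and "\<And>i. i \<in> S \<Longrightarrow> 0 \<le> a i \<and> a i \<le> 1"
  shows "1 - prod a S \<le> (\<Sum>i\<in>S. 1 - a i)"
  using assms
proof (induction S rule: finite_induct)
  case (insert j S)
  have "0 \<le> (1 - a j) * (1 - prod a S)"
    using insert.prems by (intro mult_nonneg_nonneg) (auto intro!: prod_le_1)
  then show ?case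
    using insert by (simp add: algebra_simps)
qed simp

text \<open>\<open>- ln (1 - b x)\<close> is a convex function of \<open>ln x\<close>; its slope at \<open>x = 1\<close> is \<open>b / (1 - b)\<close>.\<close>
lemma powr_le_one_minus_ratio:
  fixes b x :: real
  assumes "0 \<le> b" and "1 \<le> x" and "b * x < 1"
  shows "x powr (b / (1 - b)) \<le> (1 - b) / (1 - b * x)"
proof -
  define w where "w = b / (1 - b)"
  have b1: "b < 1"
    using assms mult_left_mono[of 1 x b] by auto
  have w0: "0 \<le> w"
    using assms b1 by (simp add: w_def)
  have "(1 - b * x) / (1 - b) = 1 - w * (x - 1)"
    using b1 by (simp add: w_def field_simps)
  also have "\<dots> \<le> exp (- (w * (x - 1)))"
    using exp_ge_add_one_self[of "- (w * (x - 1))"] by simp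
  also have "\<dots> \<le> exp (- (w * ln x))"
    using w0 assms ln_le_minus_one[of x] by (simp add: mult_left_mono)
  also have "\<dots> = 1 / x powr w"
    using assms by (simp add: powr_def exp_minus field_simps)
  finally have "(1 - b * x) / (1 - b) \<le> 1 / x powr w" .
  then show ?thesis
    using assms b1 by (simp add: w_def field_simps)
qed

section \<open>The recursion at two scales of the weights\<close>

text \<open>Nodes may share descendants, so the computation tree is represented by an acyclic graph.
  Finite branching and a rank that drops along edges give induction from the leaves.\<close>

locale occ_tree =
  fixes N :: "'x set" and ch :: "'x \<Rightarrow> 'x set" and rank :: "'x \<Rightarrow> nat"
  assumes ch_closed: "x \<in> N \<Longrightarrow> ch x \<subseteq> N"
    and finite_ch: "x \<in> N \<Longrightarrow> finite (ch x)"
    and rank_less: "x \<in> N \<Longrightarrow> y \<in> ch x \<Longrightarrow> rank y < rank x"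
begin

lemma rank_induct [consumes 1, case_names node]:
  assumes "x \<in> N" and "\<And>x. x \<in> N \<Longrightarrow> (\<And>y. y \<in> ch x \<Longrightarrow> P y) \<Longrightarrow> P x"
  shows "P x"
  using assms(1)
proof (induction "rank x" arbitrary: x rule: less_induct)
  case less
  then show ?case
    using assms(2) ch_closed rank_less by blast
qed

text \<open>By induction \<open>\<beta> \<le> \<beta>'\<close> at the children, so the product of
  reciprocals can only increase, and the scaled weight supplies the factor
  \<open>\<mu>\<close>.\<close>

lemma scaled_le_occ:
  assumes "is_occ N ch p \<beta>" and "is_occ N ch (\<lambda>x. \<mu> * p x) \<beta>'"
    and "subunit N \<beta>" and "subunit N \<beta>'" and "\<And>x. x \<in> N \<Longrightarrow> 0 \<le> p x" and "1 \<le> \<mu>" and "x \<in> N"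
  shows "\<mu> * \<beta> x \<le> \<beta>' x"
  using \<open>x \<in> N\<close>
proof (induction rule: rank_induct)
  case (node x)
  have "(\<Prod>y\<in>ch x. 1 / (1 - \<beta> y)) \<le> (\<Prod>y\<in>ch x. 1 / (1 - \<beta>' y))"
  proof (intro prod_mono conjI)
    fix y assume y: "y \<in> ch x"
    then have "y \<in> N" using node ch_closed by blast
    then have *: "0 \<le> \<beta> y" "\<beta> y < 1" "\<beta>' y < 1"
      using assms(3,4) by (auto simp: subunit_def)
    then have "\<beta> y \<le> \<mu> * \<beta> y" using assms(6) by (simp add: mult_le_cancel_right1)
    then have "\<beta> y \<le> \<beta>' y" using node.IH[OF y] by simp
    then show "0 \<le> 1 / (1 - \<beta> y)" "1 / (1 - \<beta> y) \<le> 1 / (1 - \<beta>' y)"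
      using * by (auto simp: frac_le)
  qed
  then have "\<mu> * (p x * (\<Prod>y\<in>ch x. 1 / (1 - \<beta> y))) \<le> \<mu> * (p x * (\<Prod>y\<in>ch x. 1 / (1 - \<beta>' y)))"
    using assms(5,6) node.hyps by (intro mult_left_mono) auto
  moreover have "\<beta> x = p x * (\<Prod>y\<in>ch x. 1 / (1 - \<beta> y))" "\<beta>' x = \<mu> * p x * (\<Prod>y\<in>ch x. 1 / (1 - \<beta>' y))"
    using assms(1,2) node.hyps unfolding is_occ_def by blast+
  ultimately show ?case by simp
qed

lemma growth_ge_1: "subunit N \<beta> \<Longrightarrow> x \<in> N \<Longrightarrow> 1 \<le> growth ch \<beta> k x"
proof (induction k arbitrary: x)
  case (Suc k)
  have "0 \<le> (\<Sum>y\<in>ch x. \<beta> y / (1 - \<beta> y) * growth ch \<beta> k y)"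
  proof (intro sum_nonneg mult_nonneg_nonneg)
    fix y assume "y \<in> ch x"
    then have "y \<in> N" using Suc.prems ch_closed by blast
    then show "0 \<le> \<beta> y / (1 - \<beta> y)" "0 \<le> growth ch \<beta> k y"
      using Suc by (auto simp: subunit_def intro: order_trans[of 0 1])
  qed
  then show ?case by simp
qed simp

text \<open>This integrates the statement that \<open>D\<close> is the logarithmic derivative:
  \<open>ln \<beta>\<close> is convex in the logarithm of the scale and lies above its tangent. The
  bound at a child \<open>y\<close> enters the convexity inequality with
  \<open>x = \<mu> powr growth ch \<beta> k y\<close>; the exponents of the children add up to
  \<open>D - 1\<close>, and the factor \<open>\<mu>\<close> of the weight contributes the missing
  1.\<close>

lemma occ_growth:
  assumes "is_occ N ch p \<beta>" and "is_occ N ch (\<lambda>x. \<mu> * p x) \<beta>'"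
    and "subunit N \<beta>" and "subunit N \<beta>'" and "\<And>x. x \<in> N \<Longrightarrow> 0 \<le> p x" and "1 \<le> \<mu>" and "x \<in> N"
  shows "\<beta> x * \<mu> powr growth ch \<beta> k x \<le> \<beta>' x"
  using \<open>x \<in> N\<close>
proof (induction k arbitrary: x)
  case 0
  then show ?case
    using scaled_le_occ[OF assms(1-6) 0] assms(6) by (simp add: mult.commute)
next
  case (Suc k)
  have factor: "\<mu> powr (\<beta> y / (1 - \<beta> y) * growth ch \<beta> k y) / (1 - \<beta> y) \<le> 1 / (1 - \<beta>' y)"
    if "y \<in> ch x" for y
  proof -
    have y: "y \<in> N" using that Suc.prems ch_closed by blast
    then have b: "0 \<le> \<beta> y" "\<beta> y < 1" "\<beta>' y < 1"
      using assms(3,4) by (auto simp: subunit_def)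
    have IH: "\<beta> y * \<mu> powr growth ch \<beta> k y \<le> \<beta>' y"
      using Suc.IH[OF y] .
    have "\<mu> powr (\<beta> y / (1 - \<beta> y) * growth ch \<beta> k y) = (\<mu> powr growth ch \<beta> k y) powr (\<beta> y / (1 - \<beta> y))"
      by (simp add: powr_powr mult.commute)
    also have "\<dots> \<le> (1 - \<beta> y) / (1 - \<beta> y * \<mu> powr growth ch \<beta> k y)"
      using b IH growth_ge_1[OF assms(3) y, of k] assms(6)
      by (intro powr_le_one_minus_ratio) (auto intro: ge_one_powr_ge_zero)
    also have "\<dots> \<le> (1 - \<beta> y) / (1 - \<beta>' y)"
      using b IH by (intro frac_le) auto
    finally show ?thesis
      using b by (simp add: field_simps)
  qed
  have "\<beta> x * \<mu> powr growth ch \<beta> (Suc k) x =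
      \<mu> * p x * (\<Prod>y\<in>ch x. \<mu> powr (\<beta> y / (1 - \<beta> y) * growth ch \<beta> k y) / (1 - \<beta> y))"
    using assms(1,6) Suc.prems finite_ch[OF Suc.prems]
    by (simp add: is_occ_def powr_add powr_sum prod_dividef)
  also have "\<dots> \<le> \<mu> * p x * (\<Prod>y\<in>ch x. 1 / (1 - \<beta>' y))"
    using assms(5,6) Suc.prems factor ch_closed[OF Suc.prems] assms(3)
    by (intro mult_left_mono prod_mono)
      (auto simp: subunit_def less_imp_le intro!: divide_nonneg_nonneg)
  also have "\<dots> = \<beta>' x"
    using assms(2) Suc.prems unfolding is_occ_def by (metis)
  finally show ?case .
qed

section \<open>Truncation error for nonnegative weights\<close>

lemma occ_bounds:
  assumes "is_occ N ch p \<beta>" and "subunit N \<beta>" and "\<And>x. x \<in> N \<Longrightarrow> 0 \<le> p x" and "x \<in> N"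
  shows "0 \<le> occ ch p k x \<and> occ ch p k x \<le> \<beta> x"
  using \<open>x \<in> N\<close>
proof (induction k arbitrary: x)
  case 0
  then show ?case using assms(2) by (simp add: subunit_def)
next
  case (Suc k)
  have y: "occ ch p k y < 1" "\<beta> y < 1" "occ ch p k y \<le> \<beta> y" if "y \<in> ch x" for y
    using Suc.IH[of y] that Suc.prems ch_closed assms(2) by (force simp: subunit_def)+
  have "(\<Prod>y\<in>ch x. 1 / (1 - occ ch p k y)) \<le> (\<Prod>y\<in>ch x. 1 / (1 - \<beta> y))"
    using y by (intro prod_mono conjI frac_le) (auto simp: less_imp_le)
  then have "p x * (\<Prod>y\<in>ch x. 1 / (1 - occ ch p k y)) \<le> p x * (\<Prod>y\<in>ch x. 1 / (1 - \<beta> y))"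
    using assms(3) Suc.prems by (intro mult_left_mono) auto
  moreover have "\<beta> x = p x * (\<Prod>y\<in>ch x. 1 / (1 - \<beta> y))"
    using assms(1) Suc.prems unfolding is_occ_def by blast
  moreover have "0 \<le> p x * (\<Prod>y\<in>ch x. 1 / (1 - occ ch p k y))"
    using assms(3) Suc.prems y by (intro mult_nonneg_nonneg prod_nonneg) (auto simp: less_imp_le)
  ultimately show ?case by simp
qed

text \<open>Truncation multiplies \<open>\<beta> x\<close> by the product of the factors
  \<open>a y\<close>, each at most 1. Linearising the product, and replacing the truncated
  denominators by the smaller \<open>1 - \<beta> y\<close>, produces the edge weights.\<close>

lemma occ_error_step:
  assumes "is_occ N ch p \<beta>" and "subunit N \<beta>" and "\<And>x. x \<in> N \<Longrightarrow> 0 \<le> p x" and "x \<in> N"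
    and e: "\<And>y. y \<in> ch x \<Longrightarrow> \<beta> y - occ ch p k y \<le> \<beta> y * e y"
  shows "\<beta> x - occ ch p (Suc k) x \<le> \<beta> x * (\<Sum>y\<in>ch x. \<beta> y / (1 - \<beta> y) * e y)"
proof -
  define a where "a y = (1 - \<beta> y) / (1 - occ ch p k y)" for y
  have y: "0 \<le> occ ch p k y" "occ ch p k y < 1" "\<beta> y < 1" "occ ch p k y \<le> \<beta> y" if "y \<in> ch x" for y
    using occ_bounds[OF assms(1-3), of y k] that assms(4) ch_closed assms(2)
    by (force simp: subunit_def)+
  have "occ ch p (Suc k) x = \<beta> x * prod a (ch x)"
  proof -
    have "\<beta> x = p x * (\<Prod>y\<in>ch x. 1 / (1 - \<beta> y))"
      using assms(1,4) unfolding is_occ_def by blast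
    moreover have "(\<Prod>y\<in>ch x. 1 / (1 - occ ch p k y)) = (\<Prod>y\<in>ch x. 1 / (1 - \<beta> y)) * prod a (ch x)"
      unfolding a_def prod.distrib[symmetric]
    proof (intro prod.cong refl)
      fix z assume "z \<in> ch x"
      from y[OF this] show "1 / (1 - occ ch p k z) = 1 / (1 - \<beta> z) * ((1 - \<beta> z) / (1 - occ ch p k z))"
        by (simp add: field_simps)
    qed
    ultimately show ?thesis by simp
  qed
  then have "\<beta> x - occ ch p (Suc k) x = \<beta> x * (1 - prod a (ch x))"
    by (simp add: algebra_simps)
  also have "\<dots> \<le> \<beta> x * (\<Sum>y\<in>ch x. 1 - a y)"
    using y assms(2,4) finite_ch[OF assms(4)]
    by (intro mult_left_mono one_minus_prod_le_sum)
      (auto simp: a_def subunit_def less_imp_le intro!: divide_nonneg_nonneg)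
  also have "\<dots> \<le> \<beta> x * (\<Sum>y\<in>ch x. \<beta> y / (1 - \<beta> y) * e y)"
  proof (intro mult_left_mono sum_mono)
    fix z assume z: "z \<in> ch x"
    have "1 - a z = (\<beta> z - occ ch p k z) / (1 - occ ch p k z)"
      using y[OF z] by (simp add: a_def field_simps)
    also have "\<dots> \<le> (\<beta> z - occ ch p k z) / (1 - \<beta> z)"
      using y[OF z] by (intro frac_le) auto
    also have "\<dots> \<le> \<beta> z * e z / (1 - \<beta> z)"
      using y[OF z] e[OF z] by (intro divide_right_mono) auto
    finally show "1 - a z \<le> \<beta> z / (1 - \<beta> z) * e z" by simp
  qed (use assms in \<open>auto simp: subunit_def\<close>)
  finally show ?thesis .
qed

text \<open>
  The potential is the geometric mean of the growth at both parameters, tilted by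
  \<open>\<mu> powr (D / 2)\<close>: passing from \<open>\<beta>\<close> to \<open>\<beta>'\<close> gains \<open>\<mu> powr D\<close> on the edge weights, while
  \<open>\<Sum> w D\<close> over the children loses a factor \<open>1 - 1 / D\<close>. By AM-GM
  \<open>D ln \<mu> + 1 / D \<ge> 2 sqrt (ln \<mu>)\<close>, whatever \<open>D\<close> is.
\<close>
definition potential :: "real \<Rightarrow> ('x \<Rightarrow> real) \<Rightarrow> ('x \<Rightarrow> real) \<Rightarrow> nat \<Rightarrow> 'x \<Rightarrow> real" where
  "potential \<mu> \<beta> \<beta>' k x =
     sqrt (growth ch \<beta> k x * growth ch \<beta>' k x * \<mu> powr growth ch \<beta> k x)"

lemma sum_potential_le:
  assumes "is_occ N ch p \<beta>" and "is_occ N ch (\<lambda>x. \<mu> * p x) \<beta>'"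
    and "subunit N \<beta>" and "subunit N \<beta>'" and "\<And>x. x \<in> N \<Longrightarrow> 0 \<le> p x" and "1 \<le> \<mu>" and "x \<in> N"
  shows "(\<Sum>y\<in>ch x. \<beta> y / (1 - \<beta> y) * potential \<mu> \<beta> \<beta>' k y)
    \<le> exp (- sqrt (ln \<mu>)) * potential \<mu> \<beta> \<beta>' (Suc k) x"
proof -
  define w where "w y = \<beta> y / (1 - \<beta> y)" for y
  define w' where "w' y = \<beta>' y / (1 - \<beta>' y)" for y
  define D where "D = growth ch \<beta> (Suc k) x"
  define D' where "D' = growth ch \<beta>' (Suc k) x"
  have D1: "1 \<le> D" "1 \<le> D'"
    using growth_ge_1 assms by (auto simp: D_def D'_def simp del: growth.simps)
  have y: "0 \<le> w y" "0 \<le> w' y" "w y * \<mu> powr growth ch \<beta> k y \<le> w' y"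
      "1 \<le> growth ch \<beta> k y" "1 \<le> growth ch \<beta>' k y" if "y \<in> ch x" for y
  proof -
    have N: "y \<in> N" using that assms(7) ch_closed by blast
    then have b: "0 \<le> \<beta> y" "\<beta> y < 1" "0 \<le> \<beta>' y" "\<beta>' y < 1"
      using assms(3,4) by (auto simp: subunit_def)
    then show "0 \<le> w y" "0 \<le> w' y" by (auto simp: w_def w'_def)
    show g: "1 \<le> growth ch \<beta> k y" "1 \<le> growth ch \<beta>' k y"
      using growth_ge_1 assms(3,4) N by auto
    have m: "\<beta> y * \<mu> powr growth ch \<beta> k y \<le> \<beta>' y"
      using occ_growth[OF assms(1-6) N] .
    moreover have "\<beta> y * 1 \<le> \<beta> y * \<mu> powr growth ch \<beta> k y"
      using b g assms(6) by (intro mult_left_mono ge_one_powr_ge_zero) auto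
    ultimately have "\<beta> y * \<mu> powr growth ch \<beta> k y / (1 - \<beta> y) \<le> \<beta>' y / (1 - \<beta>' y)"
      using b by (intro frac_le) auto
    then show "w y * \<mu> powr growth ch \<beta> k y \<le> w' y"
      by (simp add: w_def w'_def)
  qed
  have "(\<Sum>y\<in>ch x. w y * potential \<mu> \<beta> \<beta>' k y)
      \<le> (\<Sum>y\<in>ch x. \<bar>sqrt (w y * growth ch \<beta> k y)\<bar> * \<bar>sqrt (w' y * growth ch \<beta>' k y)\<bar>)"
  proof (rule sum_mono)
    fix z assume z: "z \<in> ch x"
    \<comment> \<open>Under the root there are two factors \<open>w z\<close>; the tilt of the
      potential turns one of them into \<open>w' z\<close>, which prepares Cauchy-Schwarz.\<close>
    have "w z * potential \<mu> \<beta> \<beta>' k z =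
        sqrt (w z * growth ch \<beta> k z * ((w z * \<mu> powr growth ch \<beta> k z) * growth ch \<beta>' k z))"
      using y(1)[OF z] by (simp add: potential_def real_sqrt_mult mult_ac flip: power2_eq_square)
    also have "\<dots> \<le> sqrt (w z * growth ch \<beta> k z * (w' z * growth ch \<beta>' k z))"
      using y[OF z] by (intro real_sqrt_le_mono mult_left_mono mult_right_mono) auto
    also have "\<dots> = \<bar>sqrt (w z * growth ch \<beta> k z)\<bar> * \<bar>sqrt (w' z * growth ch \<beta>' k z)\<bar>"
      using y[OF z] by (simp add: real_sqrt_mult)
    finally show "w z * potential \<mu> \<beta> \<beta>' k z \<le> \<dots>" .
  qed
  also have "\<dots> \<le> L2_set (\<lambda>y. sqrt (w y * growth ch \<beta> k y)) (ch x) * L2_set (\<lambda>y. sqrt (w' y * growth ch \<beta>' k y)) (ch x)"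
    by (rule L2_set_mult_ineq)
  also have "\<dots> = sqrt ((D - 1) * (D' - 1))"
  proof -
    have "0 \<le> growth ch \<beta> k y" "0 \<le> growth ch \<beta>' k y" if "y \<in> ch x" for y
      using y(4,5)[OF that] by linarith+
    then have "L2_set (\<lambda>y. sqrt (w y * growth ch \<beta> k y)) (ch x) = sqrt (D - 1)"
      and "L2_set (\<lambda>y. sqrt (w' y * growth ch \<beta>' k y)) (ch x) = sqrt (D' - 1)"
      using y(1,2) by (simp_all add: L2_set_def D_def D'_def flip: w_def w'_def)
    then show ?thesis by (simp add: real_sqrt_mult)
  qed
  also have "\<dots> \<le> sqrt (D * exp (- 1 / D) * D')"
  proof (intro real_sqrt_le_mono mult_mono)
    \<comment> \<open>The loss \<open>D - 1 = D * (1 - 1 / D)\<close> is kept at the smaller scale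
      only; at the larger one \<open>D' - 1 \<le> D'\<close> suffices.\<close>
    have "D * (1 - 1 / D) \<le> D * exp (- 1 / D)"
      using D1 exp_ge_add_one_self[of "- 1 / D"] by (intro mult_left_mono) auto
    then show "D - 1 \<le> D * exp (- 1 / D)"
      using D1 by (simp add: algebra_simps)
  qed (use D1 in auto)
  also have "\<dots> \<le> sqrt ((exp (- sqrt (ln \<mu>)))\<^sup>2 * (D * D' * \<mu> powr D))"
  proof (rule real_sqrt_le_mono)
    define s where "s = sqrt (ln \<mu>)"
    have s: "0 \<le> ln \<mu>" "s\<^sup>2 = ln \<mu>" using assms(6) by (auto simp: s_def)
    \<comment> \<open>AM-GM for \<open>s\<^sup>2 * D\<close> and \<open>1 / D\<close>, written as a
      square.\<close>
    have "0 \<le> (s * D - 1)\<^sup>2 / D" using D1 by simp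
    also have "\<dots> = s\<^sup>2 * D + 1 / D - 2 * s"
      using D1 by (simp add: field_simps power2_eq_square)
    finally have "- 1 / D \<le> ln \<mu> * D + 2 * (- s)" using s by simp
    then have "exp (- 1 / D) \<le> exp (ln \<mu> * D + 2 * (- s))" by simp
    also have "\<dots> = \<mu> powr D * (exp (- s))\<^sup>2"
      unfolding exp_add exp_double using assms(6) by (simp add: powr_def mult.commute)
    finally have "D * D' * exp (- 1 / D) \<le> D * D' * (\<mu> powr D * (exp (- s))\<^sup>2)"
      using D1 by (intro mult_left_mono) auto
    then show "D * exp (- 1 / D) * D' \<le> (exp (- sqrt (ln \<mu>)))\<^sup>2 * (D * D' * \<mu> powr D)"
      by (simp add: s_def mult_ac)
  qed
  also have "\<dots> = exp (- sqrt (ln \<mu>)) * potential \<mu> \<beta> \<beta>' (Suc k) x"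
    unfolding potential_def D_def D'_def by (subst real_sqrt_mult) simp
  finally show ?thesis by (simp add: w_def)
qed

text \<open>At depth 0 the relative error is 1 and the potential is at least 1. Each further level
  transports the bound through the edge weights, where the potential contracts.\<close>

lemma occ_error_le_potential:
  assumes "is_occ N ch p \<beta>" and "is_occ N ch (\<lambda>x. \<mu> * p x) \<beta>'"
    and "subunit N \<beta>" and "subunit N \<beta>'" and "\<And>x. x \<in> N \<Longrightarrow> 0 \<le> p x" and "1 \<le> \<mu>" and "x \<in> N"
  shows "\<beta> x - occ ch p k x \<le> \<beta> x * (exp (- sqrt (ln \<mu>)) ^ k * potential \<mu> \<beta> \<beta>' k x)"
  using \<open>x \<in> N\<close>
proof (induction k arbitrary: x)
  case 0
  have "1 \<le> potential \<mu> \<beta> \<beta>' 0 x" using assms(6) by (simp add: potential_def)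
  then have "\<beta> x * 1 \<le> \<beta> x * potential \<mu> \<beta> \<beta>' 0 x"
    using 0 assms(3) by (intro mult_left_mono) (auto simp: subunit_def)
  then show ?case by simp
next
  case (Suc k)
  have "\<beta> x - occ ch p (Suc k) x \<le>
      \<beta> x * (\<Sum>y\<in>ch x. \<beta> y / (1 - \<beta> y) * (exp (- sqrt (ln \<mu>)) ^ k * potential \<mu> \<beta> \<beta>' k y))"
    using Suc.IH Suc.prems ch_closed by (intro occ_error_step assms) auto
  also have "\<dots> = \<beta> x * (exp (- sqrt (ln \<mu>)) ^ k * (\<Sum>y\<in>ch x. \<beta> y / (1 - \<beta> y) * potential \<mu> \<beta> \<beta>' k y))"
    by (simp add: sum_distrib_left mult_ac)
  also have "\<dots> \<le> \<beta> x * (exp (- sqrt (ln \<mu>)) ^ k * (exp (- sqrt (ln \<mu>)) * potential \<mu> \<beta> \<beta>' (Suc k) x))"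
    using sum_potential_le[OF assms(1-6) Suc.prems] assms(3) Suc.prems
    by (intro mult_left_mono) (auto simp: subunit_def)
  finally show ?case by (simp add: mult_ac)
qed

text \<open>Since \<open>\<beta> * \<mu> powr D \<le> \<beta>' < 1\<close>, the growth can be large
  only where \<open>\<beta>\<close> is small; \<open>y \<le> exp y\<close> turns this exponential
  bound into one for \<open>\<beta> * D\<close>.\<close>

lemma growth_le:
  assumes "is_occ N ch p \<beta>" and "is_occ N ch (\<lambda>x. \<mu> * p x) \<beta>'"
    and "subunit N \<beta>" and "subunit N \<beta>'" and "\<And>x. x \<in> N \<Longrightarrow> 0 \<le> p x" and "1 < \<mu>" and "x \<in> N"
  shows "\<beta> x * growth ch \<beta> k x \<le> 1 / ln \<mu>"
proof -
  have b: "0 \<le> \<beta> x" "\<beta>' x < 1" using assms(3,4,7) by (auto simp: subunit_def)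
  have "growth ch \<beta> k x * ln \<mu> \<le> exp (growth ch \<beta> k x * ln \<mu>)"
    using exp_ge_add_one_self[of "growth ch \<beta> k x * ln \<mu>"] by linarith
  also have "\<dots> = \<mu> powr growth ch \<beta> k x" using assms(6) by (simp add: powr_def)
  finally have "\<beta> x * (growth ch \<beta> k x * ln \<mu>) \<le> \<beta> x * \<mu> powr growth ch \<beta> k x"
    using b by (intro mult_left_mono)
  also have "\<dots> \<le> \<beta>' x"
    using assms by (intro occ_growth[OF assms(1-5)]) auto
  finally show ?thesis using b assms(6) by (simp add: field_simps)
qed

text \<open>The slack \<open>\<alpha>\<close> is spent in two halves: passing to the scale
  \<open>1 + \<alpha> / 2\<close> gives the contraction and controls the growth of
  \<open>\<beta>\<close>, and passing on to \<open>1 + \<alpha>\<close> controls the growth of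
  \<open>\<beta>'\<close>.\<close>

lemma occ_error_decay:
  assumes "is_occ N ch p \<beta>" and "is_occ N ch (\<lambda>x. (1 + \<alpha> / 2) * p x) \<beta>'"
    and "is_occ N ch (\<lambda>x. (1 + \<alpha>) * p x) \<beta>''"
    and "subunit N \<beta>" and "subunit N \<beta>'" and "subunit N \<beta>''"
    and "\<And>x. x \<in> N \<Longrightarrow> 0 \<le> p x" and "0 < \<alpha>" and "\<alpha> \<le> 1" and "x \<in> N"
  shows "\<beta> x - occ ch p k x \<le> 5 / \<alpha> * exp (- sqrt \<alpha> / 2 * k)"
proof -
  define \<mu> where "\<mu> = 1 + \<alpha> / 2"
  \<comment> \<open>The quotient of the scales \<open>1 + \<alpha>\<close> and
    \<open>1 + \<alpha> / 2\<close>.\<close>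
  define \<nu> where "\<nu> = 1 + \<alpha> / (2 + \<alpha>)"
  have \<mu>1: "1 < \<mu>" "1 < \<nu>" using assms(8) by (auto simp: \<mu>_def \<nu>_def)
  have ln_\<mu>: "\<alpha> / 4 \<le> ln \<mu>"
  proof -
    have "\<alpha> / 2 - (\<alpha> / 2)\<^sup>2 \<le> ln (1 + \<alpha> / 2)"
      using assms by (intro ln_one_plus_pos_lower_bound) auto
    moreover have "\<alpha> * \<alpha> \<le> \<alpha> * 1" using assms by (intro mult_left_mono) auto
    ultimately show ?thesis by (simp add: \<mu>_def power2_eq_square)
  qed
  have ln_\<nu>: "\<alpha> / 5 \<le> ln \<nu>"
  proof -
    define u where "u = \<alpha> / (2 + \<alpha>)"
    have u: "\<alpha> / 3 \<le> u" "u \<le> 1 / 3" "0 \<le> u"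
      using assms(8,9) by (auto simp: u_def field_simps intro: mult_left_mono)
    have "u - u\<^sup>2 \<le> ln (1 + u)"
      using u by (intro ln_one_plus_pos_lower_bound) auto
    moreover have "u * u \<le> u * (1 / 3)" using u by (intro mult_left_mono) auto
    moreover have "\<nu> = 1 + u" by (simp add: \<nu>_def u_def)
    ultimately have "u * (2 / 3) \<le> ln \<nu>" by (simp add: power2_eq_square)
    then show ?thesis using u assms(8) by linarith
  qed
  have \<nu>\<mu>: "is_occ N ch (\<lambda>x. \<nu> * (\<mu> * p x)) \<beta>''"
  proof -
    have "\<nu> * \<mu> = 1 + \<alpha>" using assms(8) by (simp add: \<nu>_def \<mu>_def field_simps)
    then show ?thesis using assms(3) by (simp add: mult.assoc[symmetric])
  qed
  have occ': "is_occ N ch (\<lambda>x. \<mu> * p x) \<beta>'" using assms(2) by (simp add: \<mu>_def)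
  have b: "0 \<le> \<beta> x" "0 \<le> \<beta>' x" using assms by (auto simp: subunit_def)
  define D where "D = growth ch \<beta> k x"
  define D' where "D' = growth ch \<beta>' k x"
  have D1: "1 \<le> D" "1 \<le> D'" using growth_ge_1 assms by (auto simp: D_def D'_def)
  have "\<beta> x * D \<le> 1 / ln \<mu>"
    unfolding D_def using \<mu>1 by (intro growth_le[OF assms(1) occ'] assms) auto
  also have "\<dots> \<le> 4 / \<alpha>" using ln_\<mu> \<mu>1 assms(8) by (simp add: field_simps)
  finally have 1: "\<beta> x * D \<le> 4 / \<alpha>" .
  have "\<beta>' x * D' \<le> 1 / ln \<nu>"
    unfolding D'_def using \<mu>1 by (intro growth_le[OF occ' \<nu>\<mu>] assms) (auto simp: assms)
  also have "\<dots> \<le> 5 / \<alpha>" using ln_\<nu> \<mu>1 assms(8) by (simp add: field_simps)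
  finally have 2: "\<beta>' x * D' \<le> 5 / \<alpha>" .
  have 3: "\<beta> x * \<mu> powr D \<le> \<beta>' x"
    unfolding D_def using \<mu>1 by (intro occ_growth[OF assms(1) occ'] assms) auto
  \<comment> \<open>One factor \<open>\<beta> x\<close> pays for the growth of
    \<open>\<beta>\<close>; the other absorbs the tilt, becomes \<open>\<beta>' x\<close> and pays
    for the growth of \<open>\<beta>'\<close>.\<close>
  have "(\<beta> x * potential \<mu> \<beta> \<beta>' k x)\<^sup>2 = (\<beta> x * D) * ((\<beta> x * \<mu> powr D) * D')"
    using D1 unfolding D_def D'_def by (simp add: potential_def power_mult_distrib) (simp add: power2_eq_square)
  also have "\<dots> \<le> (4 / \<alpha>) * (\<beta>' x * D')"
    using 1 3 b D1 assms(8) by (intro mult_mono mult_nonneg_nonneg) auto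
  also have "\<dots> \<le> (4 / \<alpha>) * (5 / \<alpha>)"
    using 2 assms(8) by (intro mult_left_mono) auto
  also have "\<dots> \<le> (5 / \<alpha>)\<^sup>2"
    using assms(8) by (simp add: power2_eq_square divide_right_mono)
  finally have pot: "\<beta> x * potential \<mu> \<beta> \<beta>' k x \<le> 5 / \<alpha>"
    by (rule power2_le_imp_le) (use assms(8) in simp)
  have "sqrt \<alpha> / 2 \<le> sqrt (ln \<mu>)"
    using ln_\<mu> real_sqrt_le_mono[OF ln_\<mu>] by (simp add: real_sqrt_divide)
  then have rate: "exp (- sqrt (ln \<mu>)) ^ k \<le> exp (- sqrt \<alpha> / 2 * k)"
    using mult_left_mono[of "sqrt \<alpha> / 2" "sqrt (ln \<mu>)" "real k"]
    by (simp add: mult_ac flip: exp_of_nat_mult)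
  have "\<beta> x - occ ch p k x \<le> exp (- sqrt (ln \<mu>)) ^ k * (\<beta> x * potential \<mu> \<beta> \<beta>' k x)"
    using occ_error_le_potential[OF assms(1) occ' assms(4,5,7), of x k] \<mu>1 assms(10)
    by (simp add: mult_ac)
  also have "\<dots> \<le> exp (- sqrt \<alpha> / 2 * k) * (5 / \<alpha>)"
    using rate pot b D1 by (intro mult_mono) (auto simp: potential_def D_def D'_def)
  finally show ?thesis by (simp add: mult.commute)
qed

section \<open>Domination of complex weights by real ones\<close>

lemma cmod_occ_le:
  fixes q b :: "'x \<Rightarrow> complex"
  assumes "is_occ N ch p \<beta>" and "subunit N \<beta>" and "is_occ N ch q b"
    and "\<And>x. x \<in> N \<Longrightarrow> cmod (q x) \<le> p x" and "x \<in> N"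
  shows "cmod (b x) \<le> \<beta> x"
  using \<open>x \<in> N\<close>
proof (induction rule: rank_induct)
  case (node x)
  have "cmod (b x) = cmod (q x) * (\<Prod>y\<in>ch x. cmod (1 / (1 - b y)))"
    using assms(3) node.hyps unfolding is_occ_def by (metis norm_mult prod_norm)
  also have "\<dots> \<le> p x * (\<Prod>y\<in>ch x. 1 / (1 - \<beta> y))"
  proof (intro mult_mono prod_mono conjI)
    show "cmod (q x) \<le> p x" "0 \<le> p x"
      using assms(4)[OF node.hyps] norm_ge_zero order_trans by blast+
    fix y assume y: "y \<in> ch x"
    show "cmod (1 / (1 - b y)) \<le> 1 / (1 - \<beta> y)"
      using node.IH[OF y] ch_closed node.hyps y assms(2)
      by (intro norm_one_over_diff_le(2)[of "b y" _ "\<beta> y"]) (auto simp: subunit_def)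
  qed (auto intro: prod_nonneg)
  also have "\<dots> = \<beta> x" using assms(1) node.hyps unfolding is_occ_def by metis
  finally show ?case .
qed

text \<open>Both bounds go through the induction together, since comparing the products needs
  majorants of the truncated factors as well as of the differences. At depth 0 the error is the full
  value, which \<open>cmod_occ_le\<close> bounds.\<close>

lemma cmod_occ_error_le:
  fixes q b :: "'x \<Rightarrow> complex"
  assumes "is_occ N ch p \<beta>" and "subunit N \<beta>" and "is_occ N ch q b"
    and "\<And>x. x \<in> N \<Longrightarrow> cmod (q x) \<le> p x" and "x \<in> N"
  shows "cmod (b x - occ ch q k x) \<le> \<beta> x - occ ch p k x \<and> cmod (occ ch q k x) \<le> occ ch p k x"
  using \<open>x \<in> N\<close>
proof (induction k arbitrary: x)
  case 0
  then show ?case using cmod_occ_le[OF assms(1-4)] by simp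
next
  case (Suc k)
  have p0: "0 \<le> p x" and q: "cmod (q x) \<le> p x"
    using assms(4)[OF Suc.prems] norm_ge_zero order_trans by blast+
  have N: "y \<in> N" if "y \<in> ch x" for y using that Suc.prems ch_closed by blast
  have y: "cmod (1 / (1 - b y) - 1 / (1 - occ ch q k y)) \<le> 1 / (1 - \<beta> y) - 1 / (1 - occ ch p k y)"
     "cmod (1 / (1 - occ ch q k y)) \<le> 1 / (1 - occ ch p k y)" if "y \<in> ch x" for y
    using norm_one_over_diff_le[of "b y" "occ ch q k y" "\<beta> y" "occ ch p k y"]
      Suc.IH[OF N[OF that]] cmod_occ_le[OF assms(1-4) N[OF that]] N[OF that] assms(2)
    by (auto simp: subunit_def)
  have bx: "b x = q x * (\<Prod>y\<in>ch x. 1 / (1 - b y))" "\<beta> x = p x * (\<Prod>y\<in>ch x. 1 / (1 - \<beta> y))"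
    using assms(1,3) Suc.prems unfolding is_occ_def by blast+
  have "cmod (b x - occ ch q (Suc k) x) =
      cmod (q x) * cmod ((\<Prod>y\<in>ch x. 1 / (1 - b y)) - (\<Prod>y\<in>ch x. 1 / (1 - occ ch q k y)))"
    by (subst bx) (simp add: norm_mult[symmetric] algebra_simps)
  also have "\<dots> \<le> p x * ((\<Prod>y\<in>ch x. 1 / (1 - \<beta> y)) - (\<Prod>y\<in>ch x. 1 / (1 - occ ch p k y)))"
    using y p0 q finite_ch[OF Suc.prems] by (intro mult_mono prod_diff_dominated) auto
  also have "\<dots> = \<beta> x - occ ch p (Suc k) x"
    by (subst bx) (simp add: algebra_simps)
  finally have 1: "cmod (b x - occ ch q (Suc k) x) \<le> \<beta> x - occ ch p (Suc k) x" .
  have "cmod (occ ch q (Suc k) x) = cmod (q x) * (\<Prod>y\<in>ch x. cmod (1 / (1 - occ ch q k y)))"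
    by (simp only: occ.simps norm_mult prod_norm)
  also have "\<dots> \<le> p x * (\<Prod>y\<in>ch x. 1 / (1 - occ ch p k y))"
    using y p0 q by (intro mult_mono prod_mono prod_nonneg) auto
  finally show ?case using 1 by simp
qed

end

section \<open>Ratios of independence polynomials\<close>

definition nbrs :: "'a set set \<Rightarrow> 'a \<Rightarrow> 'a set" where
  "nbrs E v = {u. {v, u} \<in> E}"

text \<open>The node \<open>(A, v)\<close> stands for the ratio \<open>Z\<^sub>A\<^sub>+\<^sub>v / Z\<^sub>A\<close>.\<close>
definition nodes :: "'a set \<Rightarrow> ('a set \<times> 'a) set" where
  "nodes V = {(A, v). insert v A \<subseteq> V \<and> v \<notin> A}"

text \<open>The order of the vertices fixes the order of removal: the child for \<open>u\<close> has
  lost \<open>u\<close> and all smaller neighbours of \<open>v\<close>. The program scans the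
  vertices in the same order.\<close>

definition children :: "'a::linorder set set \<Rightarrow> 'a set \<times> 'a \<Rightarrow> ('a set \<times> 'a) set" where
  "children E x = (case x of (A, v) \<Rightarrow> (\<lambda>u. (A - {w \<in> nbrs E v. w \<le> u}, u)) ` (A \<inter> nbrs E v))"

definition gen_poly :: "'a set set \<Rightarrow> ('a \<Rightarrow> 'f::field) \<Rightarrow> 'a set \<Rightarrow> 'f" where
  "gen_poly E x A = (\<Sum>I\<in>indep_sets A E. \<Prod>v\<in>I. x v)"

definition occ_ratio :: "'a set set \<Rightarrow> ('a \<Rightarrow> 'f::field) \<Rightarrow> 'a set \<times> 'a \<Rightarrow> 'f" where
  "occ_ratio E x = (\<lambda>(A, v). 1 - gen_poly E x (insert v A) / gen_poly E x A)"

section \<open>Deletion recurrence and telescoping\<close>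

lemma indep_poly_eq_gen_poly: "indep_poly A E x = gen_poly E x A"
  by (simp add: indep_poly_def gen_poly_def)

lemma gen_poly_of_real: "gen_poly E (\<lambda>v. complex_of_real (x v)) A = of_real (gen_poly E x A)"
  by (simp add: gen_poly_def)

lemma finite_indep_sets: "finite A \<Longrightarrow> finite (indep_sets A E)"
  by (rule finite_subset[of _ "Pow A"]) (auto simp: indep_sets_def)

lemma finite_nbrs: "sgraph V E \<Longrightarrow> finite (nbrs E v)"
  by (rule finite_subset[of _ V]) (auto simp: nbrs_def sgraph_def)

lemma gen_poly_empty: "gen_poly E x {} = 1"
proof -
  have "indep_sets {} E = {{}}" by (auto simp: indep_sets_def)
  then show ?thesis by (simp add: gen_poly_def)
qed

text \<open>The independent sets containing \<open>v\<close> are \<open>v\<close> together with an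
  independent set that avoids its neighbours.\<close>

lemma gen_poly_insert:
  assumes "sgraph V E" and "finite A" and "v \<notin> A"
  shows "gen_poly E x (insert v A) = gen_poly E x A + x v * gen_poly E x (A - nbrs E v)"
proof -
  let ?B = "A - nbrs E v"
  have vv: "{v, v} \<notin> E" using assms(1) by (auto simp: sgraph_def)
  have split: "indep_sets (insert v A) E = indep_sets A E \<union> insert v ` indep_sets ?B E"
  proof (intro equalityI subsetI)
    fix I assume I: "I \<in> indep_sets (insert v A) E"
    show "I \<in> indep_sets A E \<union> insert v ` indep_sets ?B E"
    proof (cases "v \<in> I")
      case True
      then have "I = insert v (I - {v})" by auto
      moreover have "I - {v} \<in> indep_sets ?B E"
        using I True by (auto simp: indep_sets_def nbrs_def)
      ultimately show ?thesis by blast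
    next
      case False
      then show ?thesis using I by (auto simp: indep_sets_def)
    qed
  next
    fix I assume "I \<in> indep_sets A E \<union> insert v ` indep_sets ?B E"
    then show "I \<in> indep_sets (insert v A) E"
      using vv by (auto simp: indep_sets_def nbrs_def insert_commute)
  qed
  have notin: "v \<notin> I" if "I \<in> indep_sets A E" for I
    using that assms(3) by (auto simp: indep_sets_def)
  have notin': "v \<notin> I" "finite I" if "I \<in> indep_sets ?B E" for I
    using that assms(2,3) finite_subset[of I A] by (auto simp: indep_sets_def)
  have "gen_poly E x (insert v A) = gen_poly E x A + (\<Sum>I\<in>insert v ` indep_sets ?B E. \<Prod>w\<in>I. x w)"
    unfolding gen_poly_def split
    by (rule sum.union_disjoint) (use notin in \<open>auto simp: finite_indep_sets assms(2)\<close>)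
  also have "(\<Sum>I\<in>insert v ` indep_sets ?B E. \<Prod>w\<in>I. x w) = (\<Sum>I\<in>indep_sets ?B E. \<Prod>w\<in>insert v I. x w)"
    using notin' by (subst sum.reindex) (auto simp: inj_on_def insert_ident)
  also have "\<dots> = x v * gen_poly E x ?B"
    using notin' by (simp add: gen_poly_def sum_distrib_left)
  finally show ?thesis .
qed

text \<open>The elements of \<open>S\<close> leave \<open>A\<close> in increasing order, and each
  factor is the quotient of the values before and after one removal. In the induction the new
  maximum leaves last, so it changes no earlier factor and adds the quotient of
  \<open>F (A - S)\<close> and \<open>F (A - insert m S)\<close>.\<close>

lemma telescope_removal:
  fixes F :: "'a::linorder set \<Rightarrow> 'f::field"
  assumes "finite S" and "S \<subseteq> A" and "\<And>B. B \<subseteq> A \<Longrightarrow> F B \<noteq> 0"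
  shows "F A = F (A - S) * (\<Prod>u\<in>S. F (insert u (A - {w \<in> S. w \<le> u})) / F (A - {w \<in> S. w \<le> u}))"
  using assms(1,2)
proof (induction S rule: finite_linorder_max_induct)
  case (insert m S)
  let ?r = "\<lambda>S u. F (insert u (A - {w \<in> S. w \<le> u})) / F (A - {w \<in> S. w \<le> u})"
  have m: "m \<notin> S" "{w \<in> insert m S. w \<le> m} = insert m S" using insert.hyps by auto
  have u: "{w \<in> insert m S. w \<le> u} = {w \<in> S. w \<le> u}" if "u \<in> S" for u
    using that insert.hyps by auto
  have "insert m (A - insert m S) = A - S" using insert.prems m by auto
  then have "F (A - insert m S) * prod (?r (insert m S)) (insert m S) = F (A - S) * prod (?r S) S"
    using insert.hyps m u assms(3)[of "A - insert m S"] by simp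
  then show ?case using insert by simp
qed simp

lemma occ_tree_children:
  assumes "sgraph V E"
  shows "occ_tree (nodes V) (children E) (card \<circ> fst)"
proof
  fix x y assume x: "x \<in> nodes V" and y: "y \<in> children E x"
  obtain A v where xA: "x = (A, v)" by force
  have fin: "finite A"
    using x xA assms finite_subset[of A V] by (auto simp: nodes_def sgraph_def)
  obtain u where "u \<in> A" "u \<in> nbrs E v" "fst y = A - {w \<in> nbrs E v. w \<le> u}"
    using y by (auto simp: children_def xA)
  then have "fst y \<subset> A" by auto
  then show "(card \<circ> fst) y < (card \<circ> fst) x"
    using fin by (simp add: xA psubset_card_mono)
qed (use finite_nbrs[OF assms] in \<open>auto simp: nodes_def children_def\<close>)

text \<open>Dividing the deletion recurrence by \<open>Z\<^sub>A\<close> leaves the quotient of the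
  polynomials of \<open>A - nbrs E v\<close> and \<open>A\<close>; by telescoping it is the product
  of the reciprocal ratios of the children, which are the \<open>1 / (1 - b)\<close> of the
  recursion.\<close>

lemma is_occ_occ_ratio:
  assumes "sgraph V E" and "\<And>A. A \<subseteq> V \<Longrightarrow> gen_poly E x A \<noteq> 0"
  shows "is_occ (nodes V) (children E) (\<lambda>(A, v). - x v) (occ_ratio E x)"
  unfolding is_occ_def
proof
  fix X assume X: "X \<in> nodes V"
  obtain A v where XA: "X = (A, v)" by force
  have A: "finite A" "A \<subseteq> V" "v \<notin> A"
    using X XA assms finite_subset[of A V] by (auto simp: nodes_def sgraph_def)
  let ?Z = "gen_poly E x"
  let ?S = "A \<inter> nbrs E v"
  let ?B = "\<lambda>u. A - {w \<in> nbrs E v. w \<le> u}"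
  have eq: "A - {w \<in> ?S. w \<le> u} = ?B u" for u by auto
  have "?Z A = ?Z (A - ?S) * (\<Prod>u\<in>?S. ?Z (insert u (?B u)) / ?Z (?B u))"
    using telescope_removal[of ?S A ?Z] A assms(2) finite_nbrs[OF assms(1)]
    unfolding eq by (meson Int_lower1 finite_Int order_trans)
  also have "A - ?S = A - nbrs E v" by auto
  finally have tel: "?Z A = ?Z (A - nbrs E v) * (\<Prod>u\<in>?S. ?Z (insert u (?B u)) / ?Z (?B u))" .
  have aux: "1 / c = b / a" if "a = b * c" "a \<noteq> 0" for a b c :: 'b
    using that by auto
  have nz: "?Z A \<noteq> 0" "?Z (A - nbrs E v) \<noteq> 0" using A by (auto intro!: assms(2))
  have "(\<Prod>y\<in>children E X. 1 / (1 - occ_ratio E x y)) = (\<Prod>u\<in>?S. 1 / (?Z (insert u (?B u)) / ?Z (?B u)))"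
    unfolding XA children_def prod.case
    by (subst prod.reindex) (auto simp: inj_on_def occ_ratio_def)
  also have "\<dots> = 1 / (\<Prod>u\<in>?S. ?Z (insert u (?B u)) / ?Z (?B u))"
    by (simp add: prod_dividef)
  also have "\<dots> = ?Z (A - nbrs E v) / ?Z A"
    by (rule aux[OF tel nz(1)])
  finally have "(\<Prod>y\<in>children E X. 1 / (1 - occ_ratio E x y)) = ?Z (A - nbrs E v) / ?Z A" .
  moreover have "occ_ratio E x X = - x v * (?Z (A - nbrs E v) / ?Z A)"
    using nz gen_poly_insert[OF assms(1) A(1,3), of x]
    by (simp add: XA occ_ratio_def field_simps)
  ultimately show "occ_ratio E x X = (case X of (A, v) \<Rightarrow> - x v) * (\<Prod>y\<in>children E X. 1 / (1 - occ_ratio E x y))"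
    by (simp add: XA)
qed

section \<open>Nonvanishing and positivity in the Shearer region\<close>

lemma gen_poly_nonzero:
  assumes "sgraph V E" and "p \<in> shearer_region V E" and "A \<subseteq> V" and "\<And>v. v \<in> A \<Longrightarrow> cmod (x v) \<le> p v"
  shows "gen_poly E x A \<noteq> 0"
proof -
  \<comment> \<open>Weight 0 outside \<open>A\<close> reduces the induced subgraph to the whole
    graph without leaving the polydisc.\<close>
  define y where "y v = (if v \<in> A then x v else 0)" for v
  have fin: "finite V" using assms(1) by (simp add: sgraph_def)
  have p: "\<forall>v\<in>V. 0 \<le> p v" "\<forall>z. (\<forall>v\<in>V. cmod (z v) \<le> p v) \<longrightarrow> indep_poly V E z \<noteq> 0"
    using assms(2) by (auto simp: shearer_region_def)
  have "gen_poly E x A = (\<Sum>I\<in>indep_sets A E. \<Prod>v\<in>I. y v)"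
    unfolding gen_poly_def by (intro sum.cong prod.cong) (auto simp: y_def indep_sets_def)
  also have "\<dots> = (\<Sum>I\<in>indep_sets V E. \<Prod>v\<in>I. y v)"
  proof (rule sum.mono_neutral_left)
    show "indep_sets A E \<subseteq> indep_sets V E" using assms(3) by (auto simp: indep_sets_def)
    show "\<forall>I\<in>indep_sets V E - indep_sets A E. (\<Prod>v\<in>I. y v) = 0"
    proof
      fix I assume I: "I \<in> indep_sets V E - indep_sets A E"
      then obtain v where "v \<in> I" "v \<notin> A" by (auto simp: indep_sets_def)
      moreover have "finite I" using I fin finite_subset[of I V] by (auto simp: indep_sets_def)
      ultimately show "(\<Prod>v\<in>I. y v) = 0" by (auto simp: y_def)
    qed
  qed (rule finite_indep_sets[OF fin])
  also have "\<dots> = indep_poly V E y" by (simp add: indep_poly_def)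
  finally show ?thesis using p assms(4) by (auto simp: y_def)
qed

text \<open>On the segment from 0 to \<open>- p\<close> the polynomial is real and has no zero, so
  the intermediate value theorem forbids a change of sign. At the origin \<open>0 \<le> F 0\<close>
  is enough, because a zero at \<open>t = 0\<close> is excluded in the same way.\<close>

lemma gen_poly_neg_pos:
  assumes "sgraph V E" and "p \<in> shearer_region V E" and "A \<subseteq> V"
  shows "0 < gen_poly E (\<lambda>v. - p v) A"
proof (rule ccontr)
  define F where "F t = gen_poly E (\<lambda>v. - (t * p v)) A" for t :: real
  assume "\<not> ?thesis"
  then have "F 1 \<le> 0" by (simp add: F_def)
  moreover have "0 \<le> F 0"
  proof -
    have "F 0 = (\<Sum>I\<in>indep_sets A E. \<Prod>v\<in>I. (0::real))" by (simp add: F_def gen_poly_def)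
    also have "0 \<le> \<dots>" by (intro sum_nonneg prod_nonneg) auto
    finally show ?thesis .
  qed
  moreover have "continuous_on {0..1} F"
    unfolding F_def gen_poly_def by (intro continuous_intros)
  ultimately obtain t where t: "0 \<le> t" "t \<le> 1" "F t = 0"
    using IVT2'[of F 1 0 0] by auto
  have "gen_poly E (\<lambda>v. complex_of_real (- (t * p v))) A \<noteq> 0"
  proof (rule gen_poly_nonzero[OF assms])
    fix v assume "v \<in> A"
    then have "0 \<le> p v" using assms(2,3) by (auto simp: shearer_region_def)
    then show "cmod (complex_of_real (- (t * p v))) \<le> p v"
      unfolding norm_of_real using t by (simp add: abs_mult mult_left_le_one_le)
  qed
  then show False using t unfolding gen_poly_of_real F_def by simp
qed

lemma shearer_region_antimono:
  assumes "p \<in> shearer_region V E" and "\<And>v. v \<in> V \<Longrightarrow> 0 \<le> q v \<and> q v \<le> p v"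
  shows "q \<in> shearer_region V E"
proof -
  have p: "\<forall>v\<in>V. p v \<le> 1" "\<And>z. (\<And>v. v \<in> V \<Longrightarrow> cmod (z v) \<le> p v) \<Longrightarrow> indep_poly V E z \<noteq> 0"
    using assms(1) by (auto simp: shearer_region_def)
  have "indep_poly V E z \<noteq> 0" if "\<forall>v\<in>V. cmod (z v) \<le> q v" for z
    using that assms(2) by (intro p(2)) (meson order_trans)
  then show ?thesis
    using p(1) assms(2) unfolding shearer_region_def by (blast intro: order_trans)
qed

text \<open>At \<open>- p\<close> the deletion recurrence subtracts a nonnegative multiple of a
  positive value and the result is still positive, so the ratio lies in
  \<open>(0, 1]\<close>.\<close>

lemma subunit_occ_ratio:
  assumes "sgraph V E" and "p \<in> shearer_region V E"
  shows "subunit (nodes V) (occ_ratio E (\<lambda>v. - p v))"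
  unfolding subunit_def
proof
  fix X assume X: "X \<in> nodes V"
  obtain A v where XA: "X = (A, v)" by force
  have A: "finite A" "A \<subseteq> V" "v \<notin> A" "v \<in> V"
    using X XA assms finite_subset[of A V] by (auto simp: nodes_def sgraph_def)
  let ?Z = "gen_poly E (\<lambda>v. - p v)"
  have pos: "0 < ?Z A" "0 < ?Z (insert v A)" "0 < ?Z (A - nbrs E v)"
    using A by (auto intro!: gen_poly_neg_pos[OF assms])
  moreover have "0 \<le> p v * ?Z (A - nbrs E v)"
    using pos assms(2) A by (auto simp: shearer_region_def)
  ultimately show "0 \<le> occ_ratio E (\<lambda>v. - p v) X \<and> occ_ratio E (\<lambda>v. - p v) X < 1"
    using gen_poly_insert[OF assms(1) A(1,3), of "\<lambda>v. - p v"]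
    by (simp add: XA occ_ratio_def)
qed

section \<open>From ratios to the independence polynomial\<close>

definition approx_ratio :: "'a::linorder set set \<Rightarrow> ('a \<Rightarrow> complex) \<Rightarrow> nat \<Rightarrow> 'a set \<Rightarrow> 'a \<Rightarrow> complex" where
  "approx_ratio E z k A v = 1 - occ (children E) (\<lambda>(A, v). - z v) k (A, v)"

text \<open>\<open>\<beta> t\<close> belongs to the weights \<open>- t * |z|\<close>. The error at
  \<open>z\<close> is dominated by the one for \<open>\<beta> 1\<close>, and the scales up to
  \<open>1 + \<alpha>\<close> stay in the Shearer region. The same slack keeps \<open>R\<close> away
  from 0: \<open>(1 + \<alpha>) * \<beta> 1 \<le> \<beta> (1 + \<alpha>) < 1\<close>. This makes the
  absolute error a relative one.\<close>

lemma approx_ratio_error: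
  assumes "sgraph V E" and "0 < \<alpha>" and "\<alpha> \<le> 1"
    and "(\<lambda>v. (1 + \<alpha>) * cmod (z v)) \<in> shearer_region V E" and "(A, v) \<in> nodes V"
  defines "R \<equiv> gen_poly E z (insert v A) / gen_poly E z A"
  shows "cmod (approx_ratio E z k A v - R) \<le> 5 / \<alpha> * exp (- sqrt \<alpha> / 2 * k)"
    and "\<alpha> / 2 \<le> cmod R"
proof -
  interpret occ_tree "nodes V" "children E" "card \<circ> fst"
    using assms(1) by (rule occ_tree_children)
  define \<beta> where "\<beta> t = occ_ratio E (\<lambda>v. - (t * cmod (z v)))" for t
  have region: "(\<lambda>v. t * cmod (z v)) \<in> shearer_region V E" if "0 \<le> t" "t \<le> 1 + \<alpha>" for t
    using that by (intro shearer_region_antimono[OF assms(4)]) (auto intro: mult_right_mono)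
  have sub: "subunit (nodes V) (\<beta> t)" if "0 \<le> t" "t \<le> 1 + \<alpha>" for t
    unfolding \<beta>_def by (rule subunit_occ_ratio[OF assms(1) region[OF that]])
  let ?p = "\<lambda>(A :: 'a set, v). cmod (z v)"
  have occ_t: "is_occ (nodes V) (children E) (\<lambda>x. t * ?p x) (\<beta> t)" if "0 \<le> t" "t \<le> 1 + \<alpha>" for t
  proof -
    have "gen_poly E (\<lambda>v. - (t * cmod (z v))) B \<noteq> 0" if "B \<subseteq> V" for B
      using gen_poly_neg_pos[OF assms(1) region[OF \<open>0 \<le> t\<close> \<open>t \<le> 1 + \<alpha>\<close>] that] by simp
    from is_occ_occ_ratio[OF assms(1) this] show ?thesis
      by (simp add: \<beta>_def case_prod_beta')
  qed
  have occ_1: "is_occ (nodes V) (children E) ?p (\<beta> 1)"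
    using occ_t[of 1] assms(2) by simp
  have nz: "gen_poly E z B \<noteq> 0" if "B \<subseteq> V" for B
    using region[of 1] assms(2) that by (intro gen_poly_nonzero[OF assms(1), of "\<lambda>v. 1 * cmod (z v)"]) auto
  have occ_z: "is_occ (nodes V) (children E) (\<lambda>(A, v). - z v) (occ_ratio E z)"
    by (rule is_occ_occ_ratio[OF assms(1) nz])
  have R: "R = 1 - occ_ratio E z (A, v)" by (simp add: R_def occ_ratio_def)
  have p0: "0 \<le> ?p x" for x by (simp add: case_prod_beta')
  have "cmod (approx_ratio E z k A v - R) =
      cmod (occ_ratio E z (A, v) - occ (children E) (\<lambda>(A, v). - z v) k (A, v))"
    by (simp add: R approx_ratio_def)
  also have "\<dots> \<le> \<beta> 1 (A, v) - occ (children E) ?p k (A, v)"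
    using assms(2,5) sub
    by (intro cmod_occ_error_le[OF occ_1 _ occ_z, THEN conjunct1]) auto
  also have "\<dots> \<le> 5 / \<alpha> * exp (- sqrt \<alpha> / 2 * k)"
    using assms(2,3,5) p0
    by (intro occ_error_decay[OF occ_1 occ_t[of "1 + \<alpha> / 2"] occ_t[of "1 + \<alpha>"]] sub) auto
  finally show "cmod (approx_ratio E z k A v - R) \<le> 5 / \<alpha> * exp (- sqrt \<alpha> / 2 * k)" .
  have "(1 + \<alpha>) * \<beta> 1 (A, v) \<le> \<beta> (1 + \<alpha>) (A, v)"
    using assms(2,5) p0 by (intro scaled_le_occ[OF occ_1 occ_t] sub) auto
  also have "\<dots> < 1" using sub[of "1 + \<alpha>"] assms(2,5) by (auto simp: subunit_def)
  finally have "(1 + \<alpha>) * \<beta> 1 (A, v) < 1" .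
  then have "\<beta> 1 (A, v) < 1 / (1 + \<alpha>)" using assms(2) by (simp add: field_simps)
  also have "\<dots> \<le> 1 - \<alpha> / 2"
    using assms(2,3) mult_left_mono[of \<alpha> 1 \<alpha>] by (simp add: field_simps)
  finally have "\<beta> 1 (A, v) \<le> 1 - \<alpha> / 2" by simp
  moreover have "cmod (occ_ratio E z (A, v)) \<le> \<beta> 1 (A, v)"
    using assms(2,5) sub by (intro cmod_occ_le[OF occ_1 _ occ_z]) auto
  moreover have "1 - cmod (occ_ratio E z (A, v)) \<le> cmod R"
    using norm_triangle_ineq2[of 1 "occ_ratio E z (A, v)"] by (simp add: R)
  ultimately show "\<alpha> / 2 \<le> cmod R" by linarith
qed

text \<open>Domination by \<open>(1 + \<eta>) * cmod (R i)\<close> reduces the claim to \<open>(1 +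
  \<eta>) ^ card S \<le> exp (\<epsilon> / 2) \<le> 1 + \<epsilon>\<close>.\<close>

lemma is_approx_prod:
  fixes r R :: "'i \<Rightarrow> complex"
  assumes "finite S" and "0 \<le> \<epsilon>" and "\<epsilon> \<le> 1"
    and "\<And>i. i \<in> S \<Longrightarrow> cmod (r i - R i) \<le> \<epsilon> / (2 * card S) * cmod (R i)"
  shows "is_approx \<epsilon> (prod R S) (prod r S)"
proof -
  let ?\<eta> = "\<epsilon> / (2 * card S)"
  have "cmod (prod r S - prod R S) \<le> (\<Prod>i\<in>S. (1 + ?\<eta>) * cmod (R i)) - (\<Prod>i\<in>S. cmod (R i))"
    using assms by (intro prod_diff_dominated) (auto simp: algebra_simps)
  also have "\<dots> = ((1 + ?\<eta>) ^ card S - 1) * cmod (prod R S)"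
    unfolding prod.distrib by (simp add: prod_norm algebra_simps)
  also have "\<dots> \<le> \<epsilon> * cmod (prod R S)"
  proof (rule mult_right_mono)
    have "(1 + ?\<eta>) ^ card S \<le> exp ?\<eta> ^ card S"
      using assms(2) by (intro power_mono) (auto intro: exp_ge_add_one_self)
    \<comment> \<open>Equality except for empty \<open>S\<close>, where the power is 1.\<close>
    also have "\<dots> \<le> exp (\<epsilon> / 2)"
      using assms(2) by (simp flip: exp_of_nat_mult)
    also have "\<dots> \<le> 1 + \<epsilon> / 2 + (\<epsilon> / 2)\<^sup>2"
      using assms(2,3) by (intro exp_bound) auto
    also have "\<dots> \<le> 1 + \<epsilon>"
      using assms(2,3) mult_left_mono[of \<epsilon> 1 \<epsilon>] by (simp add: power2_eq_square)
    finally show "(1 + ?\<eta>) ^ card S - 1 \<le> \<epsilon>" by simp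
  qed simp
  finally show ?thesis by (simp add: is_approx_def)
qed

text \<open>Over initial segments of the vertices the ratios telescope to the whole polynomial. The
  threshold \<open>20 * n / (\<epsilon> * \<alpha>\<^sup>2)\<close> is the error constant
  \<open>5 / \<alpha>\<close> divided by the allowed error \<open>\<epsilon> / (2 * n)\<close> times
  the lower bound \<open>\<alpha> / 2\<close> of the ratios.\<close>

lemma is_approx_indep_poly:
  fixes E :: "nat set set"
  assumes "sgraph {..<n} E" and "0 < \<alpha>" and "\<alpha> \<le> 1" and "0 < \<epsilon>" and "\<epsilon> \<le> 1"
    and "(\<lambda>v. (1 + \<alpha>) * cmod (z v)) \<in> shearer_region {..<n} E"
    and "20 * n / (\<epsilon> * \<alpha>\<^sup>2) \<le> exp (sqrt \<alpha> / 2 * k)"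
  shows "is_approx \<epsilon> (indep_poly {..<n} E z) (\<Prod>v<n. approx_ratio E z k {..<v} v)"
proof -
  define R where "R v = gen_poly E z {..<Suc v} / gen_poly E z {..<v}" for v
  have nz: "gen_poly E z {..<m} \<noteq> 0" if "m \<le> n" for m
  proof (rule gen_poly_nonzero[OF assms(1,6)])
    show "cmod (z v) \<le> (1 + \<alpha>) * cmod (z v)" for v
      using assms(2) by (simp add: mult_le_cancel_right1)
  qed (use that in auto)
  have "m \<le> n \<Longrightarrow> gen_poly E z {..<m} = (\<Prod>v<m. R v)" for m
  proof (induction m)
    case 0
    show ?case by (simp add: gen_poly_empty)
  next
    case (Suc m)
    have "gen_poly E z {..<Suc m} = gen_poly E z {..<m} * R m"
      using nz[of m] Suc.prems unfolding R_def by simp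
    then show ?case using Suc.IH Suc.prems by simp
  qed
  then have Z: "indep_poly {..<n} E z = (\<Prod>v<n. R v)"
    by (simp add: indep_poly_eq_gen_poly)
  have "cmod (approx_ratio E z k {..<v} v - R v) \<le> \<epsilon> / (2 * card {..<n}) * cmod (R v)"
    if v: "v < n" for v
  proof -
    have node: "({..<v}, v) \<in> nodes {..<n}" using v by (auto simp: nodes_def)
    have "insert v {..<v} = {..<Suc v}" by auto
    then have err: "cmod (approx_ratio E z k {..<v} v - R v) \<le> 5 / \<alpha> * exp (- sqrt \<alpha> / 2 * k)"
      "\<alpha> / 2 \<le> cmod (R v)"
      using approx_ratio_error[OF assms(1-3,6) node] by (simp_all only: R_def)
    have "exp (- sqrt \<alpha> / 2 * k) = 1 / exp (sqrt \<alpha> / 2 * k)"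
      by (simp add: exp_minus inverse_eq_divide)
    also have "\<dots> \<le> 1 / (20 * n / (\<epsilon> * \<alpha>\<^sup>2))"
      using assms(2,4,7) v by (intro divide_left_mono mult_pos_pos divide_pos_pos) auto
    finally have "5 / \<alpha> * exp (- sqrt \<alpha> / 2 * k) \<le> 5 / \<alpha> * (1 / (20 * n / (\<epsilon> * \<alpha>\<^sup>2)))"
      using assms(2) by (intro mult_left_mono) auto
    also have "\<dots> = \<epsilon> / (2 * card {..<n}) * (\<alpha> / 2)"
      using assms(2) by (simp add: power2_eq_square)
    also have "\<dots> \<le> \<epsilon> / (2 * card {..<n}) * cmod (R v)"
      using err(2) assms(4) by (intro mult_left_mono) auto
    finally show ?thesis
      using err(1) by linarith
  qed
  then show ?thesis
    unfolding Z using assms(4,5) by (intro is_approx_prod) auto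
qed

section \<open>The algorithm\<close>

definition wp :: "com list \<Rightarrow> com \<Rightarrow> state \<Rightarrow> (nat \<Rightarrow> state \<Rightarrow> bool) \<Rightarrow> bool" where
  "wp P c s Q \<longleftrightarrow> (\<exists>t s'. exec P c s t s' \<and> Q t s')"

lemma wp_Skip: "wp P Skip s Q \<longleftrightarrow> Q 1 s"
  unfolding wp_def by (metis exec.Skip exec_SkipE)

lemma wp_NAssign: "wp P (NAssign a i e) s Q \<longleftrightarrow> Q (1 + ncost i + ncost e) (nupd a (nval i s) (nval e s) s)"
  unfolding wp_def by (metis exec.NAssign exec_NAssignE)

lemma wp_CAssign: "wp P (CAssign a i e) s Q \<longleftrightarrow> Q (1 + ncost i + ccost e) (cupd a (nval i s) (cval e s) s)"
  unfolding wp_def by (metis exec.CAssign exec_CAssignE)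

lemma wp_Seq: "wp P (Seq c1 c2) s Q \<longleftrightarrow> wp P c1 s (\<lambda>t1 s1. wp P c2 s1 (\<lambda>t2 s2. Q (t1 + t2) s2))"
  unfolding wp_def by (blast intro: exec.Seq elim: exec_SeqE)

lemma wp_Cond:
  "wp P (Cond b c1 c2) s Q \<longleftrightarrow> wp P (if bval b s then c1 else c2) s (\<lambda>t s'. Q (1 + bcost b + t) s')"
proof
  assume "wp P (Cond b c1 c2) s Q"
  then show "wp P (if bval b s then c1 else c2) s (\<lambda>t s'. Q (1 + bcost b + t) s')"
    unfolding wp_def by (auto elim!: exec_CondE)
next
  assume "wp P (if bval b s then c1 else c2) s (\<lambda>t s'. Q (1 + bcost b + t) s')"
  then obtain t s' where "exec P (if bval b s then c1 else c2) s t s'" "Q (1 + bcost b + t) s'"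
    unfolding wp_def by blast
  moreover from this(1) have "exec P (Cond b c1 c2) s (1 + bcost b + t) s'"
    using exec.CondTrue exec.CondFalse by (cases "bval b s") simp_all
  ultimately show "wp P (Cond b c1 c2) s Q"
    unfolding wp_def by blast
qed

lemma wp_Call: "wp P (Call p) s Q \<longleftrightarrow> p < length P \<and> wp P (P ! p) s (\<lambda>t s'. Q (1 + t) s')"
proof
  assume "wp P (Call p) s Q"
  then show "p < length P \<and> wp P (P ! p) s (\<lambda>t s'. Q (1 + t) s')"
    unfolding wp_def by (auto elim!: exec_CallE)
next
  assume "p < length P \<and> wp P (P ! p) s (\<lambda>t s'. Q (1 + t) s')"
  then show "wp P (Call p) s Q"
    unfolding wp_def using exec.Call by blast
qed

lemmas wp_simps = wp_Skip wp_NAssign wp_CAssign wp_Seq wp_Cond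

lemma wp_mono:
  assumes "wp P c s Q" and "\<And>t s'. Q t s' \<Longrightarrow> Q' t s'"
  shows "wp P c s Q'"
  using assms unfolding wp_def by blast

text \<open>The number \<open>n\<close> of rounds is known beforehand, so the invariant is indexed
  by the round and no termination measure is required. Its time \<open>t\<close> includes the tests
  passed so far, but not the final failing one.\<close>

lemma wp_Loop:
  assumes "Inv 0 0 s"
    and step: "\<And>i t s. i < n \<Longrightarrow> Inv i t s \<Longrightarrow>
      bval b s \<and> wp P c s (\<lambda>t' s'. Inv (Suc i) (t + 1 + bcost b + t') s')"
    and exit: "\<And>t s. Inv n t s \<Longrightarrow> \<not> bval b s \<and> Q (t + 1 + bcost b) s"
  shows "wp P (Loop b c) s Q"
proof -
  have "wp P (Loop b c) s (\<lambda>t'. Q (t + t'))" if "i \<le> n" "Inv i t s" for i t s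
    using that
  proof (induction i arbitrary: t s rule: inc_induct)
    case base
    then have "exec P (Loop b c) s (1 + bcost b) s" "Q (t + (1 + bcost b)) s"
      using exit[of t s] exec.LoopFalse by (simp_all add: add.assoc)
    then show ?case
      unfolding wp_def by blast
  next
    case (step i)
    then obtain t1 s1 where "bval b s" "exec P c s t1 s1" "Inv (Suc i) (t + 1 + bcost b + t1) s1"
      using assms(2)[of i t s] unfolding wp_def by auto
    moreover from step.IH[OF this(3)] obtain t2 s2 where
      "exec P (Loop b c) s1 t2 s2" "Q (t + 1 + bcost b + t1 + t2) s2"
      unfolding wp_def by auto
    ultimately have "exec P (Loop b c) s (1 + bcost b + t1 + t2) s2" "Q (t + (1 + bcost b + t1 + t2)) s2"
      using exec.LoopTrue[of b s P c t1 s1 t2 s2] by (simp_all only: add.assoc)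
    then show ?case
      unfolding wp_def by blast
  qed
  from this[of 0 0 s] show ?thesis using assms(1) by simp
qed

lemma nmem_nupd [simp]: "nmem (nupd a i k s) = (nmem s)(a := (nmem s a)(i := k))"
  by (simp add: nupd_def)

lemma cmem_nupd [simp]: "cmem (nupd a i k s) = cmem s"
  by (simp add: nupd_def)

lemma nmem_cupd [simp]: "nmem (cupd a i k s) = nmem s"
  by (simp add: cupd_def)

lemma cmem_cupd [simp]: "cmem (cupd a i k s) = (cmem s)(a := (cmem s a)(i := k))"
  by (simp add: cupd_def)

text \<open>
  The recursion for the ratios, called with the remaining depth in \<open>h\<close> and the vertex in
  \<open>v\<close>. Local variables are arrays indexed by the depth. A vertex \<open>u\<close> is available iff
  \<open>rem u = 0\<close>; otherwise \<open>rem u\<close> is the depth of the call that removed it, so that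
  this call knows which vertices it has to put back.
\<close>

definition depth :: nexp where "depth = NCell ''h'' (Num 0)"

definition idx :: nexp where "idx = NCell ''i'' depth"

definition recurse :: com where
  "recurse =
     Seq (NAssign ''rem'' idx depth)
    (Seq (NAssign ''v'' (NSub depth (Num 1)) idx)
    (Seq (NAssign ''h'' (Num 0) (NSub depth (Num 1)))
    (Seq (Call 1)
    (Seq (NAssign ''h'' (Num 0) (NAdd depth (Num 1)))
         (CAssign ''prod'' depth (CDiv (CCell ''prod'' depth) (CCell ''res'' (Num 0))))))))"

definition next_idx :: com where
  "next_idx = NAssign ''i'' depth (NAdd idx (Num 1))"

definition idx_in_range :: bexp where
  "idx_in_range = BNot (NLe (NCell ''n'' (Num 0)) idx)"

definition is_child :: bexp where
  "is_child = BAnd (NLe (NCell ''rem'' idx) (Num 0))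
     (NLe (Num 1) (NCell ''adj'' (NAdd (NCell ''row'' (NCell ''v'' depth)) idx)))"

definition visit_loop :: com where
  "visit_loop = Loop idx_in_range (Seq (Cond is_child recurse Skip) next_idx)"

definition is_removed :: bexp where
  "is_removed = BAnd (NLe (NCell ''rem'' idx) depth) (NLe depth (NCell ''rem'' idx))"

definition restore_loop :: com where
  "restore_loop = Loop idx_in_range
    (Seq (Cond is_removed (NAssign ''rem'' idx (Num 0)) Skip) next_idx)"

definition ratio_proc :: com where
  "ratio_proc = Cond (NLe depth (Num 0))
     (CAssign ''res'' (Num 0) (OfNat (Num 1)))
     (Seq (NAssign ''i'' depth (Num 0))
     (Seq (CAssign ''prod'' depth (OfNat (Num 1)))
     (Seq visit_loop
     (Seq (NAssign ''i'' depth (Num 0))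
     (Seq restore_loop
          (CAssign ''res'' (Num 0)
            (CAdd (OfNat (Num 1)) (CMul (CCell ''z'' (NCell ''v'' depth)) (CCell ''prod'' depth)))))))))"

section \<open>The recursive procedure\<close>

text \<open>What a call at depth \<open>h\<close> leaves alone. Its argument in \<open>v\<close> at
  \<open>h\<close> survives, whereas \<open>i\<close> and \<open>prod\<close> at \<open>h\<close>
  are its own locals. The marks \<open>rem\<close> are left open, because they differ in the middle
  of a call; their restoration is stated separately.\<close>

definition frame :: "nat \<Rightarrow> state \<Rightarrow> state \<Rightarrow> bool" where
  "frame h s s' \<longleftrightarrow>
     (\<forall>a. a \<noteq> ''v'' \<longrightarrow> a \<noteq> ''i'' \<longrightarrow> a \<noteq> ''rem'' \<longrightarrow> nmem s' a = nmem s a) \<and>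
     (\<forall>j\<ge>h. nmem s' ''v'' j = nmem s ''v'' j) \<and>
     (\<forall>j>h. nmem s' ''i'' j = nmem s ''i'' j) \<and>
     (\<forall>a. a \<noteq> ''prod'' \<longrightarrow> a \<noteq> ''res'' \<longrightarrow> cmem s' a = cmem s a) \<and>
     (\<forall>j>h. cmem s' ''prod'' j = cmem s ''prod'' j)"

lemma frame_refl [simp]: "frame h s s"
  by (simp add: frame_def)

lemma frame_nupd_i: "frame h s s' \<Longrightarrow> frame h s (nupd ''i'' h x s')"
  by (simp add: frame_def)

lemma frame_nupd_rem: "frame h s s' \<Longrightarrow> frame h s (nupd ''rem'' j x s')"
  by (simp add: frame_def)

lemma frame_cupd_prod: "frame h s s' \<Longrightarrow> frame h s (cupd ''prod'' h x s')"
  by (simp add: frame_def)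

lemma frame_cupd_res: "frame h s s' \<Longrightarrow> frame h s (cupd ''res'' j x s')"
  by (simp add: frame_def)

lemma frame_call:
  assumes "frame (Suc k) s s1" and "nmem s1 ''h'' 0 = Suc k"
    and "frame k (nupd ''h'' 0 k (nupd ''v'' k i (nupd ''rem'' i x s1))) s2"
  shows "frame (Suc k) s (nupd ''h'' 0 (Suc k) s2)"
proof -
  have "nmem (nupd ''h'' 0 (Suc k) s2) a = nmem s a" if "a \<noteq> ''v''" "a \<noteq> ''i''" "a \<noteq> ''rem''" for a
  proof (cases "a = ''h''")
    case True
    then have "nmem s2 a = (nmem s1 a)(0 := k)" and "nmem s1 a = nmem s a"
      using assms(1,3) by (simp_all add: frame_def)
    then show ?thesis using True assms(2) fun_upd_idem[of "nmem s a" 0 "Suc k"] by simp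
  next
    case False
    then show ?thesis using assms(1,3) that by (simp add: frame_def)
  qed
  then show ?thesis
    using assms(1,3) unfolding frame_def by (intro conjI allI impI) simp_all
qed

text \<open>The array \<open>row\<close> holds the offsets of the rows of the adjacency matrix,
  since the machine cannot multiply natural numbers.\<close>

definition graph_loaded :: "nat \<Rightarrow> nat set set \<Rightarrow> (nat \<Rightarrow> complex) \<Rightarrow> state \<Rightarrow> bool" where
  "graph_loaded n E z s \<longleftrightarrow> nmem s ''n'' 0 = n \<and>
     (\<forall>v<n. \<forall>u<n. nmem s ''adj'' (nmem s ''row'' v + u) = (if {v, u} \<in> E then 1 else 0)) \<and>
     (\<forall>v<n. cmem s ''z'' v = z v)"

lemma graph_loaded_cong:
  assumes "graph_loaded n E z s" and "nmem s' ''n'' = nmem s ''n''" and "nmem s' ''adj'' = nmem s ''adj''"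
    and "nmem s' ''row'' = nmem s ''row''" and "cmem s' ''z'' = cmem s ''z''"
  shows "graph_loaded n E z s'"
  using assms(1) unfolding graph_loaded_def by (simp add: assms(2-))

text \<open>The entry condition for the node \<open>(A, v)\<close>. Existing marks exceed
  \<open>h\<close>, so the mark \<open>h\<close> is fresh and identifies exactly the vertices that
  this call removes.\<close>

definition ready :: "nat \<Rightarrow> nat \<Rightarrow> nat set \<Rightarrow> nat \<Rightarrow> state \<Rightarrow> bool" where
  "ready n h A v s \<longleftrightarrow> nmem s ''h'' 0 = h \<and> nmem s ''v'' h = v \<and> v < n \<and>
     A = {u. u < n \<and> nmem s ''rem'' u = 0} \<and>
     (\<forall>u<n. nmem s ''rem'' u = 0 \<or> h < nmem s ''rem'' u)"

text \<open>The two scans over the vertices are charged to \<open>100 * (n + 1)\<close>; each of the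
  at most \<open>d\<close> recursive calls has an overhead of at most 50.\<close>

fun ratio_time :: "nat \<Rightarrow> nat \<Rightarrow> nat \<Rightarrow> nat" where
  "ratio_time n d 0 = 20"
| "ratio_time n d (Suc h) = 100 * (n + 1) + d * (ratio_time n d h + 50)"

lemma bcosts: "bcost idx_in_range = 7" "bcost is_child = 18" "bcost is_removed = 15"
  by (simp_all add: idx_in_range_def is_child_def is_removed_def idx_def depth_def)

lemma approx_ratio_0: "approx_ratio E z 0 A v = 1"
  by (simp add: approx_ratio_def)

lemma approx_ratio_Suc:
  "approx_ratio E z (Suc k) A v =
     1 + z v * (\<Prod>u\<in>A \<inter> nbrs E v. 1 / approx_ratio E z k (A - {w \<in> nbrs E v. w \<le> u}) u)"
proof -
  have "(\<Prod>y\<in>children E (A, v). 1 / (1 - occ (children E) (\<lambda>(A, v). - z v) k y)) =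
      (\<Prod>u\<in>A \<inter> nbrs E v. 1 / approx_ratio E z k (A - {w \<in> nbrs E v. w \<le> u}) u)"
    unfolding children_def prod.case approx_ratio_def
    by (subst prod.reindex) (auto simp: inj_on_def children_def)
  then show ?thesis by (simp add: approx_ratio_def)
qed

text \<open>Induction on the depth. When the scan reaches a child \<open>i\<close>, the smaller
  children already carry the mark \<open>h\<close>, so after marking \<open>i\<close> the unmarked
  vertices form exactly the set of the child node. Each recursive call gives back \<open>rem\<close>
  unchanged, which lets the invariant continue.\<close>

lemma wp_ratio_proc:
  assumes P: "1 < length P" "P ! 1 = ratio_proc"
    and degree: "\<And>v. v < n \<Longrightarrow> card (nbrs E v \<inter> {..<n}) \<le> d"
    and "graph_loaded n E z s" and "ready n h A v s"
  shows "wp P ratio_proc s (\<lambda>t s'. t \<le> ratio_time n d h \<and> frame h s s' \<and>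
      nmem s' ''rem'' = nmem s ''rem'' \<and> cmem s' ''res'' 0 = approx_ratio E z h A v)"
  using assms(4,5)
proof (induction h arbitrary: s A v)
  case 0
  then show ?case
    by (simp add: ratio_proc_def depth_def wp_simps ready_def frame_def approx_ratio_0)
next
  case (Suc k)
  define h where "h = Suc k"
  have h0: "0 < h" by (simp add: h_def)
  define N where "N = A \<inter> nbrs E v"
  define f where "f u = 1 / approx_ratio E z k (A - {w \<in> nbrs E v. w \<le> u}) u" for u
  define Inv where "Inv i t s' \<longleftrightarrow> frame h s s' \<and> nmem s' ''i'' h = i \<and>
      nmem s' ''rem'' = (\<lambda>u. if u < i \<and> u \<in> N then h else nmem s ''rem'' u) \<and>
      cmem s' ''prod'' h = prod f (N \<inter> {..<i}) \<and>
      t \<le> 50 * i + card (N \<inter> {..<i}) * (ratio_time n d k + 50)" for i t s'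
  \<comment> \<open>While restoring, the children from \<open>i\<close> onwards still carry their
    marks.\<close>
  define Inv' where "Inv' i t s' \<longleftrightarrow> frame h s s' \<and> nmem s' ''i'' h = i \<and>
      nmem s' ''rem'' = (\<lambda>u. if i \<le> u \<and> u \<in> N then h else nmem s ''rem'' u) \<and>
      cmem s' ''prod'' h = prod f N \<and> t \<le> 50 * i" for i t s'
  have loaded: "nmem s ''n'' 0 = n" "\<And>v u. v < n \<Longrightarrow> u < n \<Longrightarrow>
      nmem s ''adj'' (nmem s ''row'' v + u) = (if {v, u} \<in> E then 1 else 0)"
     "\<And>v. v < n \<Longrightarrow> cmem s ''z'' v = z v"
    using Suc.prems(1) by (auto simp: graph_loaded_def)
  have rdy: "nmem s ''h'' 0 = h" "nmem s ''v'' h = v" "v < n"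
      "\<And>u. u \<in> A \<longleftrightarrow> u < n \<and> nmem s ''rem'' u = 0"
      "\<And>u. u < n \<Longrightarrow> nmem s ''rem'' u = 0 \<or> h < nmem s ''rem'' u"
    using Suc.prems(2) by (auto simp: ready_def h_def)
  have N: "N \<subseteq> {..<n}" "finite N" "card N \<le> d"
  proof -
    show "N \<subseteq> {..<n}" by (auto simp: N_def rdy)
    then show "finite N" by (rule finite_subset) simp
    have "card N \<le> card (nbrs E v \<inter> {..<n})"
      by (rule card_mono) (auto simp: N_def rdy)
    then show "card N \<le> d" using degree[OF rdy(3)] by simp
  qed
  have in_N: "u \<in> N \<longleftrightarrow> nmem s ''rem'' u = 0 \<and> {v, u} \<in> E" if "u < n" for u
    using that by (auto simp: N_def rdy nbrs_def)
  have frame_mem: "nmem s' ''h'' 0 = h" "nmem s' ''n'' 0 = n" "nmem s' ''v'' h = v"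
    "nmem s' ''row'' = nmem s ''row''" "nmem s' ''adj'' = nmem s ''adj''" "cmem s' ''z'' = cmem s ''z''"
    if "frame h s s'" for s'
    using that rdy loaded by (auto simp: frame_def)
  have step: "bval idx_in_range s1 \<and> wp P (Seq (Cond is_child recurse Skip) next_idx) s1
      (\<lambda>t' s'. Inv (Suc i) (t + 1 + bcost idx_in_range + t') s')"
    if i: "i < n" and inv: "Inv i t s1" for i t s1
  proof -
    have fr: "frame h s s1" and s1: "nmem s1 ''i'' h = i"
        "nmem s1 ''rem'' = (\<lambda>u. if u < i \<and> u \<in> N then h else nmem s ''rem'' u)"
        "cmem s1 ''prod'' h = prod f (N \<inter> {..<i})"
        "t \<le> 50 * i + card (N \<inter> {..<i}) * (ratio_time n d k + 50)"
      using inv by (auto simp: Inv_def)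
    note m = frame_mem[OF fr]
    have b: "bval idx_in_range s1"
      using i by (simp add: idx_in_range_def idx_def depth_def m s1)
    have child: "bval is_child s1 \<longleftrightarrow> i \<in> N"
      using in_N[OF i] by (simp add: is_child_def idx_def depth_def m s1 loaded(2)[OF rdy(3) i])
    show ?thesis
    proof (cases "i \<in> N")
      case False
      then have same: "N \<inter> {..<Suc i} = N \<inter> {..<i}" "\<And>u. u < Suc i \<and> u \<in> N \<longleftrightarrow> u < i \<and> u \<in> N"
        by (auto simp: less_Suc_eq)
      have "Inv (Suc i) t' (nupd ''i'' h (Suc i) s1)" if "t' \<le> t + 50" for t'
        using that s1 frame_nupd_i[OF fr] unfolding Inv_def same by simp
      then show ?thesis
        using b False
        by (simp add: wp_simps child bcosts next_idx_def idx_def depth_def m s1)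
    next
      case True
      define s2 where "s2 = nupd ''h'' 0 k (nupd ''v'' k i (nupd ''rem'' i h s1))"
      define B where "B = A - {w \<in> nbrs E v. w \<le> i}"
      have "graph_loaded n E z s2"
        using fr by (intro graph_loaded_cong[OF Suc.prems(1)]) (simp_all add: s2_def frame_def)
      moreover have "ready n k B i s2"
      proof -
        have "u \<in> B \<longleftrightarrow> u < n \<and> nmem s2 ''rem'' u = 0" for u
          using True by (auto simp: B_def s2_def s1 rdy N_def h_def)
        then have "B = {u. u < n \<and> nmem s2 ''rem'' u = 0}" by blast
        moreover have "nmem s2 ''rem'' u = 0 \<or> k < nmem s2 ''rem'' u" if "u < n" for u
          using rdy(5)[OF that] by (auto simp: s2_def s1 h_def)
        ultimately show ?thesis
          using i by (simp add: ready_def s2_def)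
      qed
      ultimately have call: "wp P ratio_proc s2 (\<lambda>t s'. t \<le> ratio_time n d k \<and> frame k s2 s' \<and>
          nmem s' ''rem'' = nmem s2 ''rem'' \<and> cmem s' ''res'' 0 = approx_ratio E z k B i)"
        by (rule Suc.IH)
      have Suc_i: "N \<inter> {..<Suc i} = insert i (N \<inter> {..<i})" using True by auto
      have restored: "nmem s' ''h'' 0 = k" "nmem s' ''i'' h = i"
          "cmem s' ''prod'' h = prod f (N \<inter> {..<i})" if "frame k s2 s'" for s'
      proof -
        have "k < h" by (simp add: h_def)
        with that show "nmem s' ''h'' 0 = k" "nmem s' ''i'' h = i" "cmem s' ''prod'' h = prod f (N \<inter> {..<i})"
          by (simp_all add: frame_def s2_def s1)
      qed
      let ?after = "\<lambda>s'. nupd ''i'' h (Suc i) (cupd ''prod'' h (cmem s' ''prod'' h / cmem s' ''res'' 0)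
           (nupd ''h'' 0 h s'))"
      have after: "Inv (Suc i) t' (?after s')"
        if "ta \<le> ratio_time n d k" and fr': "frame k s2 s'"
          and s': "nmem s' ''rem'' = nmem s2 ''rem''" "cmem s' ''res'' 0 = approx_ratio E z k B i"
          and t': "t' \<le> t + 100 + ta"
        for ta t' s'
      proof -
        have "nmem (?after s') ''rem'' = (\<lambda>u. if u < Suc i \<and> u \<in> N then h else nmem s ''rem'' u)"
          using True by (auto simp: s' s2_def s1 fun_eq_iff less_Suc_eq)
        moreover have "prod f (N \<inter> {..<Suc i}) = cmem s' ''prod'' h / cmem s' ''res'' 0"
          using N(2) by (simp add: Suc_i f_def[of i] B_def s' restored[OF fr'])
        moreover have "t' \<le> 50 * Suc i + card (N \<inter> {..<Suc i}) * (ratio_time n d k + 50)"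
          using that(1) t' s1(4) N(2) by (simp add: Suc_i)
        moreover have "frame h s (?after s')"
          unfolding h_def using fr m(1) fr'
          by (intro frame_nupd_i frame_cupd_prod, intro frame_call[of k s s1 i h])
            (simp_all add: h_def s2_def)
        ultimately show ?thesis by (simp add: Inv_def)
      qed
      have b': "bval idx_in_range s1" "bval is_child s1" using b child True by auto
      \<comment> \<open>40 is the cost of the test, of the three assignments before the call and of
        the call instruction.\<close>
      have code: "wp P (Seq (Cond is_child recurse Skip) next_idx) s1 Q \<longleftrightarrow>
          wp P ratio_proc s2 (\<lambda>ta s'. wp P
            (Seq (Seq (NAssign ''h'' (Num 0) (NAdd depth (Num 1)))
              (CAssign ''prod'' depth (CDiv (CCell ''prod'' depth) (CCell ''res'' (Num 0))))) next_idx)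
            s' (\<lambda>tb. Q (40 + ta + tb)))" for Q
        using P b'(2) by (simp add: wp_simps wp_Call recurse_def bcosts idx_def depth_def m s1(1)[unfolded h_def] s2_def h_def add_ac)
      show ?thesis
        unfolding code
      proof (intro conjI b' wp_mono[OF call], elim conjE)
        fix ta s'
        assume s': "ta \<le> ratio_time n d k" "frame k s2 s'"
          "nmem s' ''rem'' = nmem s2 ''rem''" "cmem s' ''res'' 0 = approx_ratio E z k B i"
        show "wp P (Seq (Seq (NAssign ''h'' (Num 0) (NAdd depth (Num 1)))
              (CAssign ''prod'' depth (CDiv (CCell ''prod'' depth) (CCell ''res'' (Num 0))))) next_idx)
            s' (\<lambda>tb. Inv (Suc i) (t + 1 + bcost idx_in_range + (40 + ta + tb)))"
          using after[OF s'] restored[OF s'(2)]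
          by (simp add: wp_simps bcosts next_idx_def idx_def depth_def h_def)
      qed
    qed
  qed
  have step': "bval idx_in_range s1 \<and> wp P (Seq (Cond is_removed (NAssign ''rem'' idx (Num 0)) Skip) next_idx) s1
      (\<lambda>t' s'. Inv' (Suc i) (t + 1 + bcost idx_in_range + t') s')"
    if i: "i < n" and inv: "Inv' i t s1" for i t s1
  proof -
    have fr: "frame h s s1" and s1: "nmem s1 ''i'' h = i"
        "nmem s1 ''rem'' = (\<lambda>u. if i \<le> u \<and> u \<in> N then h else nmem s ''rem'' u)"
        "cmem s1 ''prod'' h = prod f N" "t \<le> 50 * i"
      using inv by (auto simp: Inv'_def)
    note m = frame_mem[OF fr]
    have b: "bval idx_in_range s1"
      using i by (simp add: idx_in_range_def idx_def depth_def m s1)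
    \<comment> \<open>All older marks are 0 or above \<open>h\<close>, and \<open>h > 0\<close>, so
      the mark \<open>h\<close> can only stem from this call.\<close>
    have removed: "bval is_removed s1 \<longleftrightarrow> i \<in> N"
      using rdy(5)[OF i] h0 by (auto simp: is_removed_def idx_def depth_def m s1)
    show ?thesis
    proof (cases "i \<in> N")
      case False
      then have same: "Suc i \<le> u \<and> u \<in> N \<longleftrightarrow> i \<le> u \<and> u \<in> N" for u
        by (auto simp: Suc_le_eq order_less_le)
      have "Inv' (Suc i) t' (nupd ''i'' h (Suc i) s1)" if "t' \<le> t + 50" for t'
        using that s1 frame_nupd_i[OF fr] unfolding Inv'_def same by simp
      then show ?thesis
        using b False
        by (simp add: wp_simps removed bcosts next_idx_def idx_def depth_def m s1)
    next
      case True
      then have "nmem s ''rem'' i = 0" using in_N[OF i] by simp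
      then have "(\<lambda>u. if Suc i \<le> u \<and> u \<in> N then h else nmem s ''rem'' u) = (nmem s1 ''rem'')(i := 0)"
        by (auto simp: s1 fun_eq_iff Suc_le_eq order_less_le)
      then have "Inv' (Suc i) t' (nupd ''i'' h (Suc i) (nupd ''rem'' i 0 s1))" if "t' \<le> t + 50" for t'
        using that s1(3,4) frame_nupd_i[OF frame_nupd_rem[OF fr]] by (simp add: Inv'_def)
      then show ?thesis
        using b True
        by (simp add: wp_simps removed bcosts next_idx_def idx_def depth_def m s1)
    qed
  qed
  have exit: "\<not> bval idx_in_range s1" if "frame h s s1" "nmem s1 ''i'' h = n" for s1
    using that(2) frame_mem[OF that(1)] by (simp add: idx_in_range_def idx_def depth_def)
  have N_lt: "N \<inter> {..<n} = N" "\<And>u. u < n \<and> u \<in> N \<longleftrightarrow> u \<in> N" "\<And>u. \<not> (n \<le> u \<and> u \<in> N)"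
    using N(1) by auto
  \<comment> \<open>8 is the cost of the final failing test, which the invariant does not
    count.\<close>
  have loop': "wp P restore_loop s1 (\<lambda>t. Inv' n (t - 8))" if "Inv' 0 0 s1" for s1
    unfolding restore_loop_def
  proof (rule wp_Loop[where Inv = Inv' and n = n, OF that step'])
    fix t s' assume "Inv' n t s'"
    then show "\<not> bval idx_in_range s' \<and> Inv' n (t + 1 + bcost idx_in_range - 8) s'"
      using exit[of s'] by (simp add: bcosts Inv'_def)
  qed
  have loop: "wp P visit_loop s1 (\<lambda>t. Inv n (t - 8))" if "Inv 0 0 s1" for s1
    unfolding visit_loop_def
  proof (rule wp_Loop[where Inv = Inv and n = n, OF that step])
    fix t s' assume "Inv n t s'"
    then show "\<not> bval idx_in_range s' \<and> Inv n (t + 1 + bcost idx_in_range - 8) s'"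
      using exit[of s'] by (simp add: bcosts Inv_def)
  qed
  \<comment> \<open>31 is the cost of the procedure outside its two loops.\<close>
  have result: "31 + t1 + t2 \<le> ratio_time n d h \<and> frame h s (cupd ''res'' 0 x s2) \<and>
      nmem s2 ''rem'' = nmem s ''rem'' \<and> 1 + z v * cmem s2 ''prod'' h = approx_ratio E z h A v"
    if "Inv n (t1 - 8) s1" "Inv' n (t2 - 8) s2" for t1 t2 s1 s2 x
  proof -
    have "card N * (ratio_time n d k + 50) \<le> d * (ratio_time n d k + 50)"
      using N(3) by (rule mult_right_mono) simp
    moreover have "t1 - 8 \<le> 50 * n + card N * (ratio_time n d k + 50)" "t2 - 8 \<le> 50 * n"
      using that by (simp_all add: Inv_def Inv'_def N_lt)
    moreover have "31 + t1 + t2 \<le> 100 * (n + 1) + b"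
      if "a \<le> b" "t1 - 8 \<le> 50 * n + a" "t2 - 8 \<le> 50 * n" for a b :: nat
      using that by arith
    ultimately have "31 + t1 + t2 \<le> 100 * (n + 1) + d * (ratio_time n d k + 50)" by blast
    then have "31 + t1 + t2 \<le> ratio_time n d h" by (simp only: h_def ratio_time.simps)
    moreover have "approx_ratio E z h A v = 1 + z v * prod f N"
      by (simp add: h_def approx_ratio_Suc N_def f_def)
    ultimately show ?thesis
      using that by (simp add: Inv'_def N_lt frame_cupd_res)
  qed
  have start: "Inv 0 0 (cupd ''prod'' h 1 (nupd ''i'' h 0 s))"
    by (simp add: Inv_def frame_cupd_prod frame_nupd_i)
  let ?x = "\<lambda>s'. 1 + cmem s' ''z'' (nmem s' ''v'' (nmem s' ''h'' 0)) * cmem s' ''prod'' (nmem s' ''h'' 0)"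
  have "wp P visit_loop (cupd ''prod'' h 1 (nupd ''i'' h 0 s)) (\<lambda>t1 s1.
      wp P restore_loop (nupd ''i'' (nmem s1 ''h'' 0) 0 s1) (\<lambda>t2 s2.
        31 + t1 + t2 \<le> ratio_time n d h \<and> frame h s (cupd ''res'' 0 (?x s2) s2) \<and>
        nmem s2 ''rem'' = nmem s ''rem'' \<and> ?x s2 = approx_ratio E z h A v))"
  proof (rule wp_mono[OF loop[OF start]])
    fix t1 s1 assume inv: "Inv n (t1 - 8) s1"
    then have fr: "frame h s s1" by (simp add: Inv_def)
    have mid: "Inv' 0 0 (nupd ''i'' h 0 s1)"
      using inv by (simp add: Inv_def Inv'_def N_lt frame_nupd_i)
    show "wp P restore_loop (nupd ''i'' (nmem s1 ''h'' 0) 0 s1) (\<lambda>t2 s2.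
        31 + t1 + t2 \<le> ratio_time n d h \<and> frame h s (cupd ''res'' 0 (?x s2) s2) \<and>
        nmem s2 ''rem'' = nmem s ''rem'' \<and> ?x s2 = approx_ratio E z h A v)"
      unfolding frame_mem(1)[OF fr]
    proof (rule wp_mono[OF loop'[OF mid]])
      fix t2 s2 assume inv': "Inv' n (t2 - 8) s2"
      then have fr': "frame h s s2" by (simp add: Inv'_def)
      have "?x s2 = 1 + z v * cmem s2 ''prod'' h"
        by (simp add: frame_mem[OF fr'] loaded(3)[OF rdy(3)])
      then show "31 + t1 + t2 \<le> ratio_time n d h \<and> frame h s (cupd ''res'' 0 (?x s2) s2) \<and>
          nmem s2 ''rem'' = nmem s ''rem'' \<and> ?x s2 = approx_ratio E z h A v"
        using result[OF inv inv'] by simp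
    qed
  qed
  then show ?case
    unfolding h_def[symmetric] using h0
    by (simp add: ratio_proc_def wp_simps depth_def rdy(1) numeral_eq_Suc del: ratio_time.simps)
qed

text \<open>
  The depth is \<open>2 m L\<close>, where \<open>m\<close> is the least number with \<open>m sqrt \<alpha> \<ge> 1\<close> and \<open>L\<close> the least one with
  \<open>20 n / (\<epsilon> \<alpha>\<^sup>2) \<le> 2 ^ L\<close>; both are found by counting, since the machine has neither
  roots nor logarithms nor products of natural numbers.
\<close>

definition find_step :: com where
  "find_step = Loop
     (BNot (ReLe (OfNat (Num 1))
       (CMul (OfNat (NCell ''m'' (Num 0))) (CMul (OfNat (NCell ''m'' (Num 0))) (CCell ''alpha'' (Num 0))))))
     (NAssign ''m'' (Num 0) (NAdd (NCell ''m'' (Num 0)) (Num 1)))"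

definition find_depth :: com where
  "find_depth = Seq
     (CAssign ''x'' (Num 0) (CDiv (CMul (OfNat (Num 20)) (OfNat (NCell ''n'' (Num 0))))
        (CMul (CCell ''eps'' (Num 0)) (CMul (CCell ''alpha'' (Num 0)) (CCell ''alpha'' (Num 0))))))
     (Loop (BNot (ReLe (CCell ''x'' (Num 0)) (OfNat (Num 1))))
       (Seq (CAssign ''x'' (Num 0) (CDiv (CCell ''x'' (Num 0)) (OfNat (Num 2))))
            (NAssign ''H'' (Num 0) (NAdd (NCell ''H'' (Num 0))
              (NAdd (NCell ''m'' (Num 0)) (NCell ''m'' (Num 0)))))))"

definition init_arrays :: com where
  "init_arrays = Loop (BNot (NLe (NCell ''n'' (Num 0)) (NCell ''u'' (Num 0))))
     (Seq (NAssign ''rem'' (NCell ''u'' (Num 0)) (NAdd (NCell ''H'' (Num 0)) (Num 1)))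
     (Seq (NAssign ''row'' (NAdd (NCell ''u'' (Num 0)) (Num 1))
            (NAdd (NCell ''row'' (NCell ''u'' (Num 0))) (NCell ''n'' (Num 0))))
          (NAssign ''u'' (Num 0) (NAdd (NCell ''u'' (Num 0)) (Num 1)))))"

text \<open>Vertex \<open>w\<close> is released only after its own ratio has been computed; hence
  the available set during its call is \<open>{..<w}\<close>, and the ratios telescope.\<close>

definition multiply_ratios :: com where
  "multiply_ratios =
     Seq (NAssign ''h'' (Num 0) (NCell ''H'' (Num 0)))
    (Seq (CAssign ''result'' (Num 0) (OfNat (Num 1)))
    (Loop (BNot (NLe (NCell ''n'' (Num 0)) (NCell ''w'' (Num 0))))
      (Seq (NAssign ''v'' (NCell ''H'' (Num 0)) (NCell ''w'' (Num 0)))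
      (Seq (Call 1)
      (Seq (CAssign ''result'' (Num 0) (CMul (CCell ''result'' (Num 0)) (CCell ''res'' (Num 0))))
      (Seq (NAssign ''rem'' (NCell ''w'' (Num 0)) (Num 0))
           (NAssign ''w'' (Num 0) (NAdd (NCell ''w'' (Num 0)) (Num 1)))))))))"

definition main_proc :: com where
  "main_proc = Seq find_step (Seq find_depth (Seq init_arrays multiply_ratios))"

section \<open>The main program\<close>

lemma nupd_nupd: "nupd a i k (nupd a i k' s) = nupd a i k s"
  by (simp add: nupd_def)

lemma nupd_same: "nmem s a i = k \<Longrightarrow> nupd a i k s = s"
  by (auto simp: nupd_def)

lemma cupd_cupd: "cupd a i k (cupd a i k' s) = cupd a i k s"
  by (simp add: cupd_def)

lemma cupd_nupd: "cupd b j x (nupd a i k s) = nupd a i k (cupd b j x s)"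
  by (simp add: cupd_def nupd_def)

lemma wp_find_step:
  assumes "nmem s ''m'' 0 = 0" and "cmem s ''alpha'' 0 = of_real \<alpha>"
    and "1 \<le> real m * (real m * \<alpha>)" and "\<And>i. i < m \<Longrightarrow> real i * (real i * \<alpha>) < 1"
  shows "wp P find_step s (\<lambda>t s'. t \<le> 30 * (m + 1) \<and> s' = nupd ''m'' 0 m s)"
proof -
  let ?b = "BNot (ReLe (OfNat (Num 1)) (CMul (OfNat (NCell ''m'' (Num 0)))
      (CMul (OfNat (NCell ''m'' (Num 0))) (CCell ''alpha'' (Num 0)))))"
  show ?thesis
    unfolding find_step_def
  proof (rule wp_Loop[where n = m and Inv = "\<lambda>i t s'. t \<le> 30 * i \<and> s' = nupd ''m'' 0 i s"])
    show "0 \<le> 30 * (0 :: nat) \<and> s = nupd ''m'' 0 0 s"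
      using assms(1) by (simp add: nupd_same)
  next
    fix i t s'
    assume "i < m" and "t \<le> 30 * i \<and> s' = nupd ''m'' 0 i s"
    then show "bval ?b s' \<and> wp P (NAssign ''m'' (Num 0) (NAdd (NCell ''m'' (Num 0)) (Num 1))) s'
        (\<lambda>t' s'. t + 1 + bcost ?b + t' \<le> 30 * Suc i \<and> s' = nupd ''m'' 0 (Suc i) s)"
      using assms(2,4) by (simp add: wp_simps nupd_nupd not_le)
  next
    fix t s'
    assume "t \<le> 30 * m \<and> s' = nupd ''m'' 0 m s"
    then show "\<not> bval ?b s' \<and> t + 1 + bcost ?b \<le> 30 * (m + 1) \<and> s' = nupd ''m'' 0 m s"
      using assms(2,3) by simp
  qed
qed

lemma wp_find_depth:
  assumes "nmem s ''n'' 0 = n" and "nmem s ''m'' 0 = m" and "nmem s ''H'' 0 = 0"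
    and "cmem s ''alpha'' 0 = of_real \<alpha>" and "cmem s ''eps'' 0 = of_real \<epsilon>"
  defines "x \<equiv> 20 * real n / (\<epsilon> * \<alpha>\<^sup>2)"
  assumes "x \<le> 2 ^ L" and "\<And>i. i < L \<Longrightarrow> 2 ^ i < x"
  shows "wp P find_depth s (\<lambda>t s'. t \<le> 80 * (L + 1) \<and>
     s' = nupd ''H'' 0 (2 * m * L) (cupd ''x'' 0 (of_real (x / 2 ^ L)) s))"
proof -
  let ?b = "BNot (ReLe (CCell ''x'' (Num 0)) (OfNat (Num 1)))"
  let ?body = "Seq (CAssign ''x'' (Num 0) (CDiv (CCell ''x'' (Num 0)) (OfNat (Num 2))))
      (NAssign ''H'' (Num 0) (NAdd (NCell ''H'' (Num 0))
        (NAdd (NCell ''m'' (Num 0)) (NCell ''m'' (Num 0)))))"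
  let ?s = "\<lambda>i. nupd ''H'' 0 (2 * m * i) (cupd ''x'' 0 (of_real (x / 2 ^ i)) s)"
  have x: "complex_of_real x = 20 * of_nat n / (of_real \<epsilon> * (of_real \<alpha> * of_real \<alpha>))"
    by (simp add: x_def power2_eq_square)
  have start: "cupd ''x'' 0 (of_real x) s = ?s 0"
    using assms(3) by (simp add: nupd_same)
  have "wp P (Loop ?b ?body) (?s 0) (\<lambda>t s'. t \<le> 50 * (L + 1) \<and> s' = ?s L)"
  proof (rule wp_Loop[where n = L and Inv = "\<lambda>i t s'. t \<le> 50 * i \<and> s' = ?s i"])
    fix i t s'
    assume i: "i < L" and inv: "t \<le> 50 * i \<and> s' = ?s i"
    have "1 < x / 2 ^ i" using assms(8)[OF i] by simp
    then show "bval ?b s' \<and> wp P ?body s'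
        (\<lambda>t' s'. t + 1 + bcost ?b + t' \<le> 50 * Suc i \<and> s' = ?s (Suc i))"
      using inv assms(2) by (simp add: wp_simps cupd_nupd nupd_nupd cupd_cupd mult.commute)
  next
    fix t s'
    assume inv: "t \<le> 50 * L \<and> s' = ?s L"
    have "x / 2 ^ L \<le> 1" using assms(7) by simp
    then show "\<not> bval ?b s' \<and> t + 1 + bcost ?b \<le> 50 * (L + 1) \<and> s' = ?s L"
      using inv by simp
  qed simp
  then have loop: "wp P (Loop ?b ?body) (cupd ''x'' 0 (of_real x) s) (\<lambda>t s'. t \<le> 50 * (L + 1) \<and> s' = ?s L)"
    unfolding start .
  have "cval (CDiv (CMul (OfNat (Num 20)) (OfNat (NCell ''n'' (Num 0))))
      (CMul (CCell ''eps'' (Num 0)) (CMul (CCell ''alpha'' (Num 0)) (CCell ''alpha'' (Num 0))))) s = of_real x"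
    using assms(1,4,5) by (simp add: x)
  then show ?thesis
    unfolding find_depth_def wp_Seq wp_CAssign using loop by (auto elim: wp_mono)
qed

lemma wp_init_arrays:
  assumes "nmem s ''n'' 0 = n" and "nmem s ''H'' 0 = H" and "nmem s ''u'' 0 = 0"
    and "nmem s ''row'' 0 = 0"
  shows "wp P init_arrays s (\<lambda>t s'. t \<le> 40 * (n + 1) \<and>
     (\<forall>a. a \<noteq> ''rem'' \<longrightarrow> a \<noteq> ''row'' \<longrightarrow> a \<noteq> ''u'' \<longrightarrow> nmem s' a = nmem s a) \<and> cmem s' = cmem s \<and>
     (\<forall>j\<le>n. nmem s' ''row'' j = j * n) \<and> (\<forall>j<n. nmem s' ''rem'' j = Suc H))"
proof -
  let ?b = "BNot (NLe (NCell ''n'' (Num 0)) (NCell ''u'' (Num 0)))"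
  let ?Inv = "\<lambda>i t s'. t \<le> 40 * i \<and>
     (\<forall>a. a \<noteq> ''rem'' \<longrightarrow> a \<noteq> ''row'' \<longrightarrow> a \<noteq> ''u'' \<longrightarrow> nmem s' a = nmem s a) \<and> cmem s' = cmem s \<and>
     (\<forall>j\<le>i. nmem s' ''row'' j = j * n) \<and> (\<forall>j<i. nmem s' ''rem'' j = Suc H) \<and> nmem s' ''u'' 0 = i"
  show ?thesis
    unfolding init_arrays_def
  proof (rule wp_Loop[where n = n and Inv = ?Inv])
    fix i t and s' :: state assume "i < n" "?Inv i t s'"
    then show "bval ?b s' \<and> wp P (Seq (NAssign ''rem'' (NCell ''u'' (Num 0)) (NAdd (NCell ''H'' (Num 0)) (Num 1)))
     (Seq (NAssign ''row'' (NAdd (NCell ''u'' (Num 0)) (Num 1))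
            (NAdd (NCell ''row'' (NCell ''u'' (Num 0))) (NCell ''n'' (Num 0))))
          (NAssign ''u'' (Num 0) (NAdd (NCell ''u'' (Num 0)) (Num 1))))) s'
        (\<lambda>t'. ?Inv (Suc i) (t + 1 + bcost ?b + t'))"
      using assms by (simp add: wp_simps le_Suc_eq less_Suc_eq)
  qed (use assms in simp_all)
qed

lemma wp_multiply_ratios:
  assumes P: "1 < length P" "P ! 1 = ratio_proc"
    and degree: "\<And>v. v < n \<Longrightarrow> card (nbrs E v \<inter> {..<n}) \<le> d"
    and loaded: "graph_loaded n E z s" and s: "nmem s ''H'' 0 = H" "nmem s ''w'' 0 = 0"
      "\<And>j. j < n \<Longrightarrow> nmem s ''rem'' j = Suc H"
  shows "wp P multiply_ratios s (\<lambda>t s'. t \<le> n * (ratio_time n d H + 50) + 20 \<and>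
     cmem s' ''result'' 0 = (\<Prod>v<n. approx_ratio E z H {..<v} v))"
proof -
  let ?b = "BNot (NLe (NCell ''n'' (Num 0)) (NCell ''w'' (Num 0)))"
  let ?body = "Seq (NAssign ''v'' (NCell ''H'' (Num 0)) (NCell ''w'' (Num 0)))
      (Seq (Call 1)
      (Seq (CAssign ''result'' (Num 0) (CMul (CCell ''result'' (Num 0)) (CCell ''res'' (Num 0))))
      (Seq (NAssign ''rem'' (NCell ''w'' (Num 0)) (Num 0))
           (NAssign ''w'' (Num 0) (NAdd (NCell ''w'' (Num 0)) (Num 1))))))"
  define Inv where "Inv i t s' \<longleftrightarrow> t \<le> i * (ratio_time n d H + 50) \<and> graph_loaded n E z s' \<and>
     nmem s' ''h'' 0 = H \<and> nmem s' ''H'' 0 = H \<and> nmem s' ''w'' 0 = i \<and>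
     (\<forall>j<n. nmem s' ''rem'' j = (if j < i then 0 else Suc H)) \<and>
     cmem s' ''result'' 0 = (\<Prod>v<i. approx_ratio E z H {..<v} v)" for i t s'
  have n: "nmem s' ''n'' 0 = n" if "graph_loaded n E z s'" for s'
    using that by (simp add: graph_loaded_def)
  have step: "bval ?b s1 \<and> wp P ?body s1 (\<lambda>t'. Inv (Suc i) (t + 1 + bcost ?b + t'))"
    if i: "i < n" and inv: "Inv i t s1" for i t s1
  proof -
    have s1: "t \<le> i * (ratio_time n d H + 50)" "graph_loaded n E z s1" "nmem s1 ''h'' 0 = H"
        "nmem s1 ''H'' 0 = H" "nmem s1 ''w'' 0 = i"
        "\<And>j. j < n \<Longrightarrow> nmem s1 ''rem'' j = (if j < i then 0 else Suc H)"
        "cmem s1 ''result'' 0 = (\<Prod>v<i. approx_ratio E z H {..<v} v)"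
      using inv by (auto simp: Inv_def)
    let ?s2 = "nupd ''v'' H i s1"
    have loaded2: "graph_loaded n E z ?s2" by (rule graph_loaded_cong[OF s1(2)]) simp_all
    have ready: "ready n H {..<i} i ?s2"
      using i by (auto simp: ready_def s1 split: if_splits)
    have call: "wp P ratio_proc ?s2 (\<lambda>t s'. t \<le> ratio_time n d H \<and> frame H ?s2 s' \<and>
        nmem s' ''rem'' = nmem ?s2 ''rem'' \<and> cmem s' ''res'' 0 = approx_ratio E z H {..<i} i)"
      by (rule wp_ratio_proc[OF P degree loaded2 ready])
    have "wp P ratio_proc ?s2 (\<lambda>ta s'. Inv (Suc i) (t + 30 + ta)
        (nupd ''w'' 0 (Suc i) (nupd ''rem'' i 0
          (cupd ''result'' 0 (cmem s' ''result'' 0 * cmem s' ''res'' 0) s'))) \<and> nmem s' ''w'' 0 = i)"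
    proof (rule wp_mono[OF call], elim conjE)
      fix ta s'
      assume ta: "ta \<le> ratio_time n d H" and fr: "frame H ?s2 s'"
        and s': "nmem s' ''rem'' = nmem ?s2 ''rem''" "cmem s' ''res'' 0 = approx_ratio E z H {..<i} i"
      let ?s3 = "nupd ''w'' 0 (Suc i) (nupd ''rem'' i 0
          (cupd ''result'' 0 (cmem s' ''result'' 0 * cmem s' ''res'' 0) s'))"
      have "graph_loaded n E z ?s3"
        by (rule graph_loaded_cong[OF s1(2)]) (use fr in \<open>simp_all add: frame_def\<close>)
      moreover have "nmem ?s3 ''h'' 0 = H" "nmem ?s3 ''H'' 0 = H" "nmem s' ''w'' 0 = i"
        using fr s1 by (simp_all add: frame_def)
      moreover have "nmem ?s3 ''rem'' j = (if j < Suc i then 0 else Suc H)" if "j < n" for j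
        using s1(6)[OF that] by (auto simp: s')
      moreover have "cmem ?s3 ''result'' 0 = (\<Prod>v<Suc i. approx_ratio E z H {..<v} v)"
        using fr by (simp add: frame_def s1 s')
      moreover have "t + 30 + ta \<le> Suc i * (ratio_time n d H + 50)"
        using ta s1(1) by simp
      ultimately show "Inv (Suc i) (t + 30 + ta) ?s3 \<and> nmem s' ''w'' 0 = i"
        by (simp add: Inv_def)
    qed
    then have "wp P ratio_proc ?s2 (\<lambda>ta s'. Inv (Suc i) (t + 30 + ta)
        (nupd ''w'' 0 (Suc (nmem s' ''w'' 0)) (nupd ''rem'' (nmem s' ''w'' 0) 0
          (cupd ''result'' 0 (cmem s' ''result'' 0 * cmem s' ''res'' 0) s'))))"
      by (rule wp_mono) auto
    then show ?thesis
      using i P by (simp add: wp_simps wp_Call s1 n[OF s1(2)] numeral_eq_Suc)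
  qed
  let ?s0 = "cupd ''result'' 0 1 (nupd ''h'' 0 H s)"
  have start: "Inv 0 0 ?s0"
    using graph_loaded_cong[OF loaded, of ?s0] s by (simp add: Inv_def)
  have "wp P (Loop ?b ?body) ?s0 (\<lambda>t s'. t \<le> n * (ratio_time n d H + 50) + 10 \<and>
     cmem s' ''result'' 0 = (\<Prod>v<n. approx_ratio E z H {..<v} v))"
  proof (rule wp_Loop[where Inv = Inv and n = n, OF start step])
    fix t s' assume "Inv n t s'"
    then show "\<not> bval ?b s' \<and> t + 1 + bcost ?b \<le> n * (ratio_time n d H + 50) + 10 \<and>
        cmem s' ''result'' 0 = (\<Prod>v<n. approx_ratio E z H {..<v} v)"
      by (simp add: Inv_def n)
  qed
  then show ?thesis
    unfolding multiply_ratios_def wp_Seq wp_NAssign wp_CAssign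
    using s by (auto elim: wp_mono)
qed

lemma wp_main_proc:
  assumes P: "1 < length P" "P ! 1 = ratio_proc"
    and degree: "\<And>v. v < n \<Longrightarrow> card (nbrs E v \<inter> {..<n}) \<le> d"
    and m: "1 \<le> real m * (real m * \<alpha>)" "\<And>i. i < m \<Longrightarrow> real i * (real i * \<alpha>) < 1"
    and L: "20 * real n / (\<epsilon> * \<alpha>\<^sup>2) \<le> 2 ^ L" "\<And>i. i < L \<Longrightarrow> 2 ^ i < 20 * real n / (\<epsilon> * \<alpha>\<^sup>2)"
  defines "H \<equiv> 2 * m * L"
  shows "wp P main_proc (input_state n E z \<alpha> \<epsilon>) (\<lambda>t s'.
     t \<le> 60 * (m + 1) + 80 * (L + 1) + 60 * (n + 1) + n * (ratio_time n d H + 50) \<and>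
     cmem s' ''result'' 0 = (\<Prod>v<n. approx_ratio E z H {..<v} v))"
proof -
  let ?s = "input_state n E z \<alpha> \<epsilon>"
  let ?s1 = "nupd ''m'' 0 m ?s"
  let ?s2 = "nupd ''H'' 0 H (cupd ''x'' 0 (of_real (20 * real n / (\<epsilon> * \<alpha>\<^sup>2) / 2 ^ L)) ?s1)"
  have 1: "wp P find_step ?s (\<lambda>t s'. t \<le> 30 * (m + 1) \<and> s' = ?s1)"
    by (rule wp_find_step[OF _ _ m]) (simp_all add: input_state_def)
  have 2: "wp P find_depth ?s1 (\<lambda>t s'. t \<le> 80 * (L + 1) \<and> s' = ?s2)"
    unfolding H_def by (rule wp_find_depth[OF _ _ _ _ _ L]) (simp_all add: input_state_def)
  have 3: "wp P init_arrays ?s2 (\<lambda>t s'. t \<le> 40 * (n + 1) \<and>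
     (\<forall>a. a \<noteq> ''rem'' \<longrightarrow> a \<noteq> ''row'' \<longrightarrow> a \<noteq> ''u'' \<longrightarrow> nmem s' a = nmem ?s2 a) \<and> cmem s' = cmem ?s2 \<and>
     (\<forall>j\<le>n. nmem s' ''row'' j = j * n) \<and> (\<forall>j<n. nmem s' ''rem'' j = Suc H))"
    by (rule wp_init_arrays) (simp_all add: input_state_def)
  \<comment> \<open>The index lies inside the matrix and decodes to \<open>v\<close> as quotient and
    \<open>u\<close> as remainder modulo \<open>n\<close>.\<close>
  have adj: "nmem ?s ''adj'' (v * n + u) = (if {v, u} \<in> E then 1 else 0)" if "v < n" "u < n" for v u
  proof -
    have "v * n + u < Suc v * n" using that by simp
    also have "\<dots> \<le> n * n" using that by (intro mult_right_mono) auto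
    finally have "v * n + u < n * n" .
    then show ?thesis using that by (simp add: input_state_def)
  qed
  have 4: "wp P multiply_ratios s3 (\<lambda>t s'. t \<le> n * (ratio_time n d H + 50) + 20 \<and>
     cmem s' ''result'' 0 = (\<Prod>v<n. approx_ratio E z H {..<v} v))"
    if s3: "\<forall>a. a \<noteq> ''rem'' \<longrightarrow> a \<noteq> ''row'' \<longrightarrow> a \<noteq> ''u'' \<longrightarrow> nmem s3 a = nmem ?s2 a"
      "cmem s3 = cmem ?s2" "\<forall>j\<le>n. nmem s3 ''row'' j = j * n" "\<forall>j<n. nmem s3 ''rem'' j = Suc H" for s3
  proof (rule wp_multiply_ratios[OF P degree])
    have "nmem s3 ''n'' 0 = n" "nmem s3 ''adj'' = nmem ?s ''adj''" "cmem s3 ''z'' = cmem ?s ''z''"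
      "\<And>v. v < n \<Longrightarrow> nmem s3 ''row'' v = v * n"
      using s3 by (simp_all add: input_state_def)
    then show "graph_loaded n E z s3"
      unfolding graph_loaded_def using adj by (simp add: input_state_def)
    show "nmem s3 ''H'' 0 = H" "nmem s3 ''w'' 0 = 0"
      using s3(1) by (simp_all add: input_state_def)
  qed (use s3(4) in auto)
  show ?thesis
    unfolding main_proc_def wp_Seq
  proof (rule wp_mono[OF 1], elim conjE, hypsubst)
    fix t1 assume t1: "t1 \<le> 30 * (m + 1)"
    show "wp P find_depth ?s1 (\<lambda>t2 s2. wp P init_arrays s2 (\<lambda>t3 s3. wp P multiply_ratios s3 (\<lambda>t4 s4.
        t1 + (t2 + (t3 + t4)) \<le> 60 * (m + 1) + 80 * (L + 1) + 60 * (n + 1) + n * (ratio_time n d H + 50) \<and>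
        cmem s4 ''result'' 0 = (\<Prod>v<n. approx_ratio E z H {..<v} v))))"
    proof (rule wp_mono[OF 2], elim conjE, hypsubst)
      fix t2 assume t2: "t2 \<le> 80 * (L + 1)"
      show "wp P init_arrays ?s2 (\<lambda>t3 s3. wp P multiply_ratios s3 (\<lambda>t4 s4.
        t1 + (t2 + (t3 + t4)) \<le> 60 * (m + 1) + 80 * (L + 1) + 60 * (n + 1) + n * (ratio_time n d H + 50) \<and>
        cmem s4 ''result'' 0 = (\<Prod>v<n. approx_ratio E z H {..<v} v)))"
      proof (rule wp_mono[OF 3], elim conjE)
        fix t3 and s3 :: state
        assume t3: "t3 \<le> 40 * (n + 1)"
          and s3: "\<forall>a. a \<noteq> ''rem'' \<longrightarrow> a \<noteq> ''row'' \<longrightarrow> a \<noteq> ''u'' \<longrightarrow> nmem s3 a = nmem ?s2 a"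
            "cmem s3 = cmem ?s2" "\<forall>j\<le>n. nmem s3 ''row'' j = j * n" "\<forall>j<n. nmem s3 ''rem'' j = Suc H"
        show "wp P multiply_ratios s3 (\<lambda>t4 s4.
          t1 + (t2 + (t3 + t4)) \<le> 60 * (m + 1) + 80 * (L + 1) + 60 * (n + 1) + n * (ratio_time n d H + 50) \<and>
          cmem s4 ''result'' 0 = (\<Prod>v<n. approx_ratio E z H {..<v} v))"
          by (rule wp_mono[OF 4[OF s3]]) (use t1 t2 t3 in simp)
      qed
    qed
  qed
qed

section \<open>The running time\<close>

lemma card_nbrs_le_max_degree:
  assumes "sgraph V E" and "v \<in> V"
  shows "card (nbrs E v \<inter> A) \<le> max_degree V E"
proof -
  have fin: "finite V" "finite E"
    using assms(1) finite_subset[of E "Pow V"] by (auto simp: sgraph_def)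
  have "card (nbrs E v \<inter> A) = card ((\<lambda>u. {v, u}) ` (nbrs E v \<inter> A))"
    by (rule card_image[symmetric]) (auto simp: inj_on_def doubleton_eq_iff)
  also have "\<dots> \<le> vdegree E v"
    unfolding vdegree_def using fin by (intro card_mono) (auto simp: nbrs_def)
  also have "\<dots> \<le> max_degree V E"
    unfolding max_degree_def using fin assms(2) by (intro Max_ge) auto
  finally show ?thesis .
qed

text \<open>The summand \<open>200 * (n + 1)\<close> strengthens the induction: multiplied by the
  base it absorbs the overhead of a level. The base is at least 2 so that the levels grow
  geometrically even for \<open>d \<le> 1\<close>.\<close>

lemma ratio_time_le: "ratio_time n d h + 200 * (n + 1) \<le> 300 * (n + 1) * max d 2 ^ h"
proof (induction h)
  case (Suc h)
  define D where "D = max d 2"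
  define a where "a = n + 1"
  define T where "T = ratio_time n d h"
  have D: "d \<le> D" "2 \<le> D" and a: "1 \<le> a" by (auto simp: D_def a_def)
  have IH: "T + 200 * a \<le> 300 * a * D ^ h"
    using Suc by (simp add: D_def a_def T_def)
  have "2 * a \<le> a * D" "D \<le> a * D" using D a by simp_all
  then have "300 * a + 50 * D \<le> 200 * (a * D)" by linarith
  moreover have "d * (T + 50) \<le> D * T + 50 * D"
    using mult_right_mono[OF D(1), of "T + 50"] by (simp add: algebra_simps)
  moreover have "D * T + 200 * (a * D) \<le> D * (300 * a * D ^ h)"
    using mult_left_mono[OF IH, of D] by (simp add: algebra_simps)
  ultimately have "100 * a + d * (T + 50) + 200 * a \<le> D * (300 * a * D ^ h)" by linarith
  also have "\<dots> = 300 * a * D ^ Suc h" by simp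
  finally show ?case by (simp only: ratio_time.simps D_def a_def T_def)
qed simp

text \<open>With \<open>X\<close> the base of the claimed power, the depth is
  \<open>O(s * ln X)\<close>, so \<open>D ^ H\<close> is a power of \<open>X\<close> with exponent
  \<open>O(s * ln D)\<close>. The constant is 46 = 14 + 32: 14 for the polynomial factors, 32 for
  the depth.\<close>

lemma total_time_le:
  fixes n d m L :: nat and \<alpha> \<epsilon> :: real
  assumes "0 < \<alpha>" and "\<alpha> \<le> 1" and "0 < \<epsilon>" and "\<epsilon> \<le> 1"
    and m: "real m \<le> 1 + 1 / sqrt \<alpha>"
    and L: "L = 0 \<or> 2 ^ (L - 1) \<le> 20 * real n / (\<epsilon> * \<alpha>\<^sup>2)"
  shows "real (1 + (60 * (m + 1) + 80 * (L + 1) + 60 * (n + 1) + n * (ratio_time n d (2 * m * L) + 50)))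
    \<le> (real (max n 2) / (\<epsilon> * \<alpha>)) powr (46 / ln 2 * ln (real (max d 2)) / sqrt \<alpha>)"
proof -
  define D where "D = max d 2"
  define X where "X = real (max n 2) / (\<epsilon> * \<alpha>)"
  define Y where "Y = ln X"
  define s where "s = 1 / sqrt \<alpha>"
  define H where "H = 2 * m * L"
  have ea: "\<epsilon> * \<alpha> \<le> \<alpha>" "\<epsilon> * \<alpha> \<le> 1" "0 < \<epsilon> * \<alpha>"
    using assms(1-4) by (simp_all add: mult_le_one mult_left_le_one_le)
  have Xn: "real (max n 2) \<le> X" and X\<alpha>: "2 / \<alpha> \<le> X"
    using ea assms(1) frac_le[of "real (max n 2)" "real (max n 2)" "\<epsilon> * \<alpha>" 1]
      frac_le[of "real (max n 2)" 2 "\<epsilon> * \<alpha>" \<alpha>] by (auto simp: X_def)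
  have X: "2 \<le> X" "real n \<le> X" using Xn by auto
  have ln2: "0 < ln (2::real)" "1 / 2 \<le> ln (2::real)"
    using ln_le_minus_one[of "1 / 2"] by (auto simp: ln_div)
  have Y: "ln 2 \<le> Y" "Y \<le> X"
    using X ln_le_minus_one[of X] by (auto simp: Y_def)
  have s: "1 \<le> s" "s \<le> 1 / \<alpha>"
  proof -
    have "\<alpha> \<le> sqrt \<alpha>" using assms(1,2) by (simp add: real_le_rsqrt power2_eq_square mult_left_le)
    then show "1 \<le> s" "s \<le> 1 / \<alpha>"
      using assms(1,2) by (auto simp: s_def intro: frac_le)
  qed
  have m2: "real m \<le> 2 * s" using m s by (simp add: s_def)
  also have "\<dots> \<le> 2 / \<alpha>" using s by simp
  finally have mX: "real m \<le> X" using X\<alpha> by simp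
  have L2: "real L \<le> 8 * (Y / ln 2)"
  proof -
    have Y1: "1 \<le> Y / ln 2" using Y ln2 by simp
    show ?thesis
    proof (cases "L = 0")
      case False
      \<comment> \<open>Together with \<open>n \<le> n\<^sup>2\<close> this bounds the threshold by
        \<open>20 * X\<^sup>2\<close>, so \<open>L\<close> is at most
        \<open>6 + 2 * (Y / ln 2)\<close>; the factor 8 uses
        \<open>Y / ln 2 \<ge> 1\<close>.\<close>
      have "\<epsilon>\<^sup>2 \<le> \<epsilon>" using assms(3,4) by (simp add: power2_eq_square mult_left_le)
      then have "20 * real n / (\<epsilon> * \<alpha>\<^sup>2) \<le> 20 * (real (max n 2))\<^sup>2 / (\<epsilon>\<^sup>2 * \<alpha>\<^sup>2)"
        using assms(1,3) by (intro frac_le mult_left_mono mult_right_mono)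
          (auto simp: power2_eq_square intro!: order_trans[OF _ self_le_power[of "real (max n 2)" 2, unfolded power2_eq_square]])
      also have "\<dots> = 20 * X\<^sup>2" by (simp add: X_def power_divide power_mult_distrib)
      also have "\<dots> \<le> 2 ^ 5 * X\<^sup>2" by simp
      finally have "2 ^ (L - 1) \<le> 2 ^ 5 * X\<^sup>2" using L False by linarith
      then have "ln (2 ^ (L - 1)) \<le> ln (2 ^ 5 * X\<^sup>2)" using X by simp
      then have "real (L - 1) * ln 2 \<le> 5 * ln 2 + 2 * Y"
        using X ln_realpow[of 2 5] by (simp add: ln_realpow ln_mult Y_def)
      then have "real (L - 1) \<le> 5 + 2 * (Y / ln 2)"
        using ln2 by (simp add: field_simps)
      then show ?thesis using Y1 False by linarith
    next
      case True
      then have "real L = 0" by simp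
      then show ?thesis using Y1 by linarith
    qed
  qed
  have LX: "real L \<le> 16 * X"
  proof -
    have "Y / ln 2 \<le> X / (1 / 2)" using Y ln2 X by (intro frac_le) auto
    then show ?thesis using L2 by simp
  qed
  have D: "2 \<le> D" "ln 2 \<le> ln (real D)" by (auto simp: D_def)
  have H: "real H \<le> 32 * s * (Y / ln 2)"
  proof -
    \<comment> \<open>The 32 is 2 * 2 * 8: the depth is \<open>2 * m * L\<close>, with
      \<open>m \<le> 2 * s\<close> and \<open>L \<le> 8 * (Y / ln 2)\<close>.\<close>
    have "real m * real L \<le> (2 * s) * (8 * (Y / ln 2))"
      using m2 L2 s by (intro mult_mono) auto
    then show ?thesis by (simp add: H_def)
  qed
  have "real (n * ratio_time n d H) \<le> X * (300 * (2 * X) * real D ^ H)"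
  proof -
    have "ratio_time n d H \<le> 300 * (n + 1) * D ^ H"
      using ratio_time_le[of n d H] by (simp add: D_def)
    then have "real (ratio_time n d H) \<le> 300 * (real n + 1) * real D ^ H"
      by (metis (mono_tags, lifting) of_nat_1 of_nat_add of_nat_le_iff of_nat_mult of_nat_numeral of_nat_power)
    also have "\<dots> \<le> 300 * (2 * X) * real D ^ H"
      using X by (intro mult_right_mono mult_left_mono) auto
    finally show ?thesis
      using X by (simp only: of_nat_mult) (intro mult_mono, auto)
  qed
  then have "real (1 + (60 * (m + 1) + 80 * (L + 1) + 60 * (n + 1) + n * (ratio_time n d H + 50)))
      \<le> 1600 * X + 600 * X\<^sup>2 * real D ^ H"
    using X mX LX by (simp add: algebra_simps power2_eq_square)
  also have "\<dots> \<le> 2 ^ 12 * (X\<^sup>2 * real D ^ H)"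
  proof -
    have "1 * 1 \<le> X * real D ^ H"
      using X D by (intro mult_mono) auto
    then have "X * 1 \<le> X * (X * real D ^ H)"
      using X by (intro mult_left_mono) auto
    then have "X \<le> X\<^sup>2 * real D ^ H" by (simp add: power2_eq_square mult.assoc)
    moreover have "1600 * X + 600 * A \<le> 2 ^ 12 * A" if "X \<le> A" for A
      using that X by simp
    ultimately show ?thesis by (simp only: mult.assoc)
  qed
  \<comment> \<open>As \<open>X \<ge> 2\<close>, the numerical constant costs 12 more powers of
    \<open>X\<close>, which together with \<open>X\<^sup>2\<close> gives 14.\<close>
  also have "\<dots> \<le> X ^ 12 * (X\<^sup>2 * real D ^ H)"
    using X by (intro mult_right_mono power_mono) auto
  also have "\<dots> = X ^ 14 * real D ^ H" by (simp flip: power_add mult.assoc)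
  also have "\<dots> = exp (14 * Y + H * ln (real D))"
    using X D exp_of_nat_mult[of 14 "ln X"] exp_of_nat_mult[of H "ln (real D)"]
    by (simp add: exp_add Y_def)
  also have "\<dots> \<le> exp (46 / ln 2 * ln (real D) * s * Y)"
  proof -
    have "1 * 1 \<le> (ln (real D) / ln 2) * s" using D s ln2 by (intro mult_mono) auto
    then have "14 * Y * 1 \<le> 14 * Y * ((ln (real D) / ln 2) * s)"
      using Y ln2 by (intro mult_left_mono) auto
    moreover have "real H * ln (real D) \<le> 32 * s * (Y / ln 2) * ln (real D)"
      using H D ln2 by (intro mult_right_mono) auto
    moreover have "46 / ln 2 * ln (real D) * s * Y = 14 * Y * ((ln (real D) / ln 2) * s) + 32 * s * (Y / ln 2) * ln (real D)"
      by (simp add: field_simps)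
    ultimately show ?thesis unfolding exp_le_cancel_iff by linarith
  qed
  also have "\<dots> = X powr (46 / ln 2 * ln (real D) / sqrt \<alpha>)"
    using X by (simp add: powr_def Y_def s_def)
  finally show ?thesis by (simp add: H_def D_def X_def)
qed

text \<open>The program and the constant are chosen before the input. The maxima with 2 keep the
  base at least 2 and the logarithm positive for \<open>n \<le> 1\<close> or
  \<open>d \<le> 1\<close>, where a run still takes some steps.\<close>

theorem theorem1p1:
  shows "\<exists>(P :: com list) (C :: real). C > 0 \<and>
    (\<forall>(n :: nat) (E :: nat set set) (d :: nat) (\<alpha> :: real) (\<epsilon> :: real) (z :: nat \<Rightarrow> complex).
       sgraph {..<n} E \<longrightarrow> d = max_degree {..<n} E \<longrightarrow>
       0 < \<alpha> \<longrightarrow> \<alpha> \<le> 1 \<longrightarrow> 0 < \<epsilon> \<longrightarrow> \<epsilon> \<le> 1 \<longrightarrow>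
       (\<lambda>v. (1 + \<alpha>) * cmod (z v)) \<in> shearer_region {..<n} E \<longrightarrow>
       (\<exists>t W. computes_in_time P (input_state n E z \<alpha> \<epsilon>) t W \<and>
              is_approx \<epsilon> (indep_poly {..<n} E z) W \<and>
              real t \<le> (real (max n 2) / (\<epsilon> * \<alpha>)) powr (C * ln (real (max d 2)) / sqrt \<alpha>)))"
proof (intro exI[of _ "[main_proc, ratio_proc]"] exI[of _ "46 / ln 2"] conjI allI impI)
  fix n d :: nat and E :: "nat set set" and \<alpha> \<epsilon> :: real and z :: "nat \<Rightarrow> complex"
  assume graph: "sgraph {..<n} E" and d: "d = max_degree {..<n} E"
    and \<alpha>: "0 < \<alpha>" "\<alpha> \<le> 1" and \<epsilon>: "0 < \<epsilon>" "\<epsilon> \<le> 1"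
    and region: "(\<lambda>v. (1 + \<alpha>) * cmod (z v)) \<in> shearer_region {..<n} E"
  let ?P = "[main_proc, ratio_proc]"
  let ?x = "20 * real n / (\<epsilon> * \<alpha>\<^sup>2)"
  define m where "m = (LEAST m. 1 \<le> real m * (real m * \<alpha>))"
  define L where "L = (LEAST L. ?x \<le> 2 ^ L)"
  have ex_m: "\<exists>m. 1 \<le> real m * (real m * \<alpha>)"
  proof -
    obtain k where k: "1 / \<alpha> < real k" using reals_Archimedean2 by blast
    then have "1 \<le> real k * \<alpha>" using \<alpha> by (simp add: field_simps)
    moreover have "1 \<le> real k" using k \<alpha> order_trans[of 1 "1 / \<alpha>" "real k"] by simp
    ultimately have "1 * 1 \<le> real k * (real k * \<alpha>)" by (intro mult_mono) auto
    then show ?thesis by auto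
  qed
  then have m: "1 \<le> real m * (real m * \<alpha>)" unfolding m_def by (rule LeastI_ex)
  have m_less: "real i * (real i * \<alpha>) < 1" if "i < m" for i
    using not_less_Least[OF that[unfolded m_def]] by simp
  have "\<exists>L. ?x \<le> 2 ^ L"
    using real_arch_pow[of 2 ?x] less_imp_le by (metis one_less_numeral_iff semiring_norm(76))
  then have L: "?x \<le> 2 ^ L" unfolding L_def by (rule LeastI_ex)
  have L_less: "2 ^ i < ?x" if "i < L" for i
    using not_less_Least[OF that[unfolded L_def]] by simp
  have m_le: "real m \<le> 1 + 1 / sqrt \<alpha>"
  proof (cases m)
    case (Suc k)
    have "(real k * sqrt \<alpha>)\<^sup>2 < 1\<^sup>2"
      using m_less[of k] Suc \<alpha> by (simp add: power_mult_distrib) (simp add: power2_eq_square mult_ac)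
    then have "real k * sqrt \<alpha> < 1" by (rule power2_less_imp_less) simp
    then show ?thesis using Suc \<alpha> by (simp add: field_simps)
  qed (use \<alpha> in simp)
  \<comment> \<open>The program tests the squared form of this inequality, which avoids the
    root.\<close>
  have m_ge: "1 \<le> real m * sqrt \<alpha>"
  proof (rule power2_le_imp_le)
    show "1\<^sup>2 \<le> (real m * sqrt \<alpha>)\<^sup>2"
      using m \<alpha> by (simp add: power_mult_distrib) (simp add: power2_eq_square mult_ac)
  qed (use \<alpha> in simp)
  \<comment> \<open>The 2 in the depth cancels the half in the decay rate: the exponent is
    \<open>m * sqrt \<alpha> * L \<ge> L\<close>, and \<open>2 \<le> exp 1\<close>.\<close>
  have accuracy: "?x \<le> exp (sqrt \<alpha> / 2 * real (2 * m * L))"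
  proof -
    have "(2::real) ^ L \<le> exp 1 ^ L"
      using exp_ge_add_one_self[of 1] by (intro power_mono) auto
    also have "\<dots> = exp (1 * real L)" by (simp flip: exp_of_nat_mult)
    also have "\<dots> \<le> exp ((real m * sqrt \<alpha>) * real L)"
      unfolding exp_le_cancel_iff using m_ge by (rule mult_right_mono) simp
    finally show ?thesis using L by (simp add: mult_ac)
  qed
  have degree: "card (nbrs E v \<inter> {..<n}) \<le> d" if "v < n" for v
    using card_nbrs_le_max_degree[OF graph] that d by simp
  have "wp ?P main_proc (input_state n E z \<alpha> \<epsilon>) (\<lambda>t s'.
     t \<le> 60 * (m + 1) + 80 * (L + 1) + 60 * (n + 1) + n * (ratio_time n d (2 * m * L) + 50) \<and>
     cmem s' ''result'' 0 = (\<Prod>v<n. approx_ratio E z (2 * m * L) {..<v} v))"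
    using degree m m_less L L_less by (intro wp_main_proc) auto
  then obtain t s' where run: "exec ?P main_proc (input_state n E z \<alpha> \<epsilon>) t s'"
    "t \<le> 60 * (m + 1) + 80 * (L + 1) + 60 * (n + 1) + n * (ratio_time n d (2 * m * L) + 50)"
    "cmem s' ''result'' 0 = (\<Prod>v<n. approx_ratio E z (2 * m * L) {..<v} v)"
    unfolding wp_def by blast
  have "exec ?P (Call 0) (input_state n E z \<alpha> \<epsilon>) (1 + t) s'"
    using run(1) by (intro exec.Call) simp_all
  then have "computes_in_time ?P (input_state n E z \<alpha> \<epsilon>) (1 + t)
      (\<Prod>v<n. approx_ratio E z (2 * m * L) {..<v} v)"
    using run(3) unfolding computes_in_time_def by blast
  moreover have "is_approx \<epsilon> (indep_poly {..<n} E z) (\<Prod>v<n. approx_ratio E z (2 * m * L) {..<v} v)"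
    by (rule is_approx_indep_poly[OF graph \<alpha> \<epsilon> region accuracy])
  moreover have "real (1 + t) \<le> (real (max n 2) / (\<epsilon> * \<alpha>)) powr (46 / ln 2 * ln (real (max d 2)) / sqrt \<alpha>)"
  proof -
    \<comment> \<open>Minimality of \<open>L\<close> speaks about \<open>L - 1\<close> only if
      \<open>L\<close> is positive.\<close>
    have "L = 0 \<or> 2 ^ (L - 1) \<le> ?x" using L_less[of "L - 1"] by force
    from total_time_le[OF \<alpha> \<epsilon> m_le this, of d] show ?thesis
      using run(2) by linarith
  qed
  ultimately show "\<exists>t W. computes_in_time ?P (input_state n E z \<alpha> \<epsilon>) t W \<and>
      is_approx \<epsilon> (indep_poly {..<n} E z) W \<and>
      real t \<le> (real (max n 2) / (\<epsilon> * \<alpha>)) powr (46 / ln 2 * ln (real (max d 2)) / sqrt \<alpha>)"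
    by blast
qed simp

end
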